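(* Let $\alpha,\beta>-1$ and $w(x)=(1-x)^\alpha(1+x)^\beta$ on $[-1,1]$. For any $f\in D(\overline{\mathcal{E}})$ and any interval $I=[a,b]\subset[-1,1]$, $$\int_I|f(x)-f_I|^2w(x)\,dx\le c\,(\operatorname{diam}_\rho(I))^2\int_I|f'(x)|^2(1-x^2)w(x)\,dx,$$ where $\operatorname{diam}_\rho(I)=\arccos a-\arccos b$, $f_I=\frac1{w(I)}\int_If(x)w(x)\,dx$ with $w(I)=\int_Iw(x)\,dx$, and $c>0$ is a constant depending only on $\alpha,\beta$.
   Context: $D(\overline{\mathcal{E}})$ is the domain of the closure $\overline{\mathcal{E}}$ of the form $\mathcal{E}(f,g)=\int_{-1}^1(1-x^2)f'(x)g'(x)w(x)\,dx$ with initial domain $C^2[-1,1]$; it is the set of weakly differentiable functions $f$ on $(-1,1)$ such that $\int_{-1}^1|f(x)|^2w(x)\,dx+\int_{-1}^1(1-x^2)|f'(x)|^2w(x)\,dx<\infty$. *)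

theory Defs
  imports "HOL-Analysis.Analysis"
begin

definition jacobi_weight :: "real \<Rightarrow> real \<Rightarrow> real \<Rightarrow> real" where
  "jacobi_weight \<alpha> \<beta> x = (1 - x) powr \<alpha> * (1 + x) powr \<beta>"

definition test_functions :: "real set \<Rightarrow> (real \<Rightarrow> real) set" where
  "test_functions S =
     {\<phi>. (\<forall>n x. (deriv ^^ n) \<phi> field_differentiable (at x)) \<and>
         (\<exists>K. compact K \<and> K \<subseteq> S \<and> (\<forall>x. x \<notin> K \<longrightarrow> \<phi> x = 0))}"

definition locally_integrable_on :: "(real \<Rightarrow> real) \<Rightarrow> real set \<Rightarrow> bool"
    (infixr \<open>locally'_integrable'_on\<close> 46) where
  "f locally_integrable_on S \<longleftrightarrow>
     (\<forall>K. compact K \<and> K \<subseteq> S \<longrightarrow> set_integrable lebesgue K f)"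

text \<open>A weak derivative is unique only up to null sets, hence a relation.\<close>

definition has_weak_derivative_on ::
    "(real \<Rightarrow> real) \<Rightarrow> (real \<Rightarrow> real) \<Rightarrow> real set \<Rightarrow> bool" where
  "has_weak_derivative_on f f' S \<longleftrightarrow>
     f locally_integrable_on S \<and> f' locally_integrable_on S \<and>
     (\<forall>\<phi> \<in> test_functions S.
        (LINT x:S|lebesgue. f x * deriv \<phi> x) = - (LINT x:S|lebesgue. f' x * \<phi> x))"

text \<open>The domain of the closure of the form
  \<open>(f, g) \<mapsto> \<integral> (1 - x\<^sup>2) f' g' w\<close> with initial domain \<open>C\<^sup>2[-1,1]\<close>, in its description as a
  weighted Sobolev space. Its elements are representatives of almost-everywhere classes; the
  second integrability condition does not depend on the chosen weak derivative.\<close>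

definition jacobi_form_domain :: "real \<Rightarrow> real \<Rightarrow> (real \<Rightarrow> real) set" where
  "jacobi_form_domain \<alpha> \<beta> =
     {f. set_integrable lebesgue {-1..1} (\<lambda>x. \<bar>f x\<bar>\<^sup>2 * jacobi_weight \<alpha> \<beta> x) \<and>
         (\<exists>f'. has_weak_derivative_on f f' {-1<..<1} \<and>
               set_integrable lebesgue {-1..1}
                 (\<lambda>x. (1 - x\<^sup>2) * \<bar>f' x\<bar>\<^sup>2 * jacobi_weight \<alpha> \<beta> x))}"

definition jacobi_mass :: "real \<Rightarrow> real \<Rightarrow> real set \<Rightarrow> real" where
  "jacobi_mass \<alpha> \<beta> I = (LINT x:I|lebesgue. jacobi_weight \<alpha> \<beta> x)"

definition jacobi_mean :: "real \<Rightarrow> real \<Rightarrow> (real \<Rightarrow> real) \<Rightarrow> real set \<Rightarrow> real" where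
  "jacobi_mean \<alpha> \<beta> f I =
     1 / jacobi_mass \<alpha> \<beta> I * (LINT x:I|lebesgue. f x * jacobi_weight \<alpha> \<beta> x)"

end

theory Submission
  imports Defs
begin

text \<open>
  The substitution \<open>x = cos \<theta>\<close> turns the claim into a Poincare inequality for the weight
  \<open>w (cos \<theta>) sin \<theta>\<close> on subintervals of \<open>[0, \<pi>]\<close>, with the length of
  the interval as diameter. This weight need not be an $A_2$ weight, so the Cauchy--Schwarz
  inequality alone fails. What saves the argument is a one-sided bound on each half of
  \<open>[-1, 1]\<close>; on the right half it says that for \<open>0 \<le> t \<le> b \<le> 1\<close>
  \[ \int_t^b w \le K (b - t) w(t) \le K (\arccos t - \arccos b) \sqrt{1 - t^2}\, w(t), \]
  so moving towards an endpoint \<open>\<plusminus>1\<close> the mass that lies ahead is controlled by the weight at the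
  current point (\<open>nn_integral_jacobi_weight_tail\<close>, \<open>diff_le_arccos_diff\<close>).

  The mean is the best constant in weighted \<open>L\<^sup>2\<close> (\<open>variance_le_second_moment\<close>), hence \<open>f\<^sub>I\<close> may be
  replaced by \<open>f m\<close> with \<open>m\<close> the point of \<open>I\<close> nearest to \<open>0\<close>. Each of the two parts of \<open>I\<close> beside
  \<open>m\<close> then lies in one half of \<open>[-1, 1]\<close> and extends from \<open>m\<close> towards an endpoint. On it,
  writing \<open>f x - f m\<close> as an integral of \<open>f'\<close>, the Cauchy--Schwarz inequality with the measure
  $dt/\sqrt{1-t^2}$, whose mass is a difference of arccosines, gives one factor of the diameter;
  exchanging the order of integration and using the tail bound gives the other (\<open>hardy_right\<close>;
  \<open>hardy_left\<close> is its mirror image; \<open>hardy_around_point\<close> combines both).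

  To start this argument a weakly differentiable \<open>f\<close> has to be identified with a primitive of
  its weak derivative (\<open>weak_derivative_imp_primitive\<close>), and any weak derivative has to agree with
  the one that witnesses membership in the form domain (\<open>weak_derivative_unique\<close>). Both rest on
  the fundamental lemma of the calculus of variations
  (\<open>fundamental_lemma_calculus_of_variations\<close>), and that one on smooth bump functions.
\<close>

section \<open>Smooth bump functions\<close>

definition smooth :: "(real \<Rightarrow> real) \<Rightarrow> bool" where
  "smooth f \<longleftrightarrow> (\<forall>n x. (deriv ^^ n) f field_differentiable (at x))"

lemma smooth_deriv_iff:
  "smooth f \<longleftrightarrow> (\<forall>x. f field_differentiable (at x)) \<and> smooth (deriv f)"
proof
  assume *: "smooth f"
  have "f field_differentiable (at x)" for x
    using *[unfolded smooth_def, rule_format, of 0] by simp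
  moreover have "smooth (deriv f)"
    unfolding smooth_def
    using *[unfolded smooth_def, rule_format, of "Suc _"] by (simp add: funpow_swap1)
  ultimately show "(\<forall>x. f field_differentiable (at x)) \<and> smooth (deriv f)" by blast
next
  assume *: "(\<forall>x. f field_differentiable (at x)) \<and> smooth (deriv f)"
  show "smooth f"
    unfolding smooth_def
  proof (intro allI)
    fix n x
    show "(deriv ^^ n) f field_differentiable at x"
      using * by (cases n) (auto simp: smooth_def funpow_swap1)
  qed
qed

text \<open>
  If differentiation does not lead out of a class of functions, then all iterated derivatives of
  its members exist. This avoids closed formulas for higher derivatives, such as the Leibniz
  rule.
\<close>

lemma smooth_coinduct:
  assumes "P f"
    and step: "\<And>g. P g \<Longrightarrow> \<exists>g'. P g' \<and> (\<forall>x. (g has_real_derivative g' x) (at x))"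
  shows "smooth f"
proof -
  have deriv_P: "P (deriv g) \<and> (\<forall>x. g field_differentiable (at x))" if Pg: "P g" for g
  proof -
    obtain g' where g': "P g'" "\<And>x. (g has_real_derivative g' x) (at x)"
      using step[OF Pg] by blast
    then have "deriv g = g'"
      by (auto intro!: ext DERIV_imp_deriv)
    with g' show ?thesis
      by (auto simp: field_differentiable_def)
  qed
  have "P ((deriv ^^ n) f)" for n
    by (induction n) (use assms(1) deriv_P in auto)
  then show ?thesis
    unfolding smooth_def using deriv_P by blast
qed

lemma smooth_imp_DERIV: "smooth f \<Longrightarrow> (f has_real_derivative deriv f x) (at x)"
  using smooth_deriv_iff field_differentiable_derivI by blast

lemma smooth_imp_continuous_on: "smooth f \<Longrightarrow> continuous_on S f"
  by (meson DERIV_isCont continuous_at_imp_continuous_on smooth_imp_DERIV)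

text \<open>
  For \<open>p = 1\<close> this is the standard smooth function that is flat at
  \<open>0\<close>. The polynomial factor makes the family closed under differentiation.
\<close>

definition flat_exp :: "real poly \<Rightarrow> real \<Rightarrow> real" where
  "flat_exp p x = (if x > 0 then poly p (1 / x) * exp (- (1 / x)) else 0)"

lemma poly_times_exp_minus_tendsto_0:
  "((\<lambda>y. poly p y * exp (- y)) \<longlongrightarrow> (0::real)) at_top"
proof -
  have "((\<lambda>y. \<Sum>i\<le>degree p. coeff p i * (y ^ i / exp y)) \<longlongrightarrow> (\<Sum>i\<le>degree p. coeff p i * 0)) at_top"
    by (intro tendsto_intros tendsto_power_div_exp_0)
  then show ?thesis
    by (simp add: poly_altdef sum_distrib_right exp_minus divide_inverse mult.assoc)
qed

text \<open>
  For \<open>x > 0\<close> differentiating \<open>p (1/x) exp (- 1/x)\<close> produces the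
  factor \<open>1/x\<^sup>2\<close>, which is the polynomial \<open>[:0, 0, 1:]\<close> at
  \<open>1/x\<close>. At \<open>0\<close> the difference quotient is \<open>0\<close> from the
  left, and from the right it is again of the form \<open>q (1/x) exp (- 1/x)\<close> and tends
  to \<open>0\<close>.
\<close>

lemma flat_exp_has_derivative:
  "(flat_exp p has_real_derivative flat_exp ([:0, 0, 1:] * (p - pderiv p)) x) (at x)"
proof -
  consider "x > 0" | "x < 0" | "x = 0" by linarith
  then show ?thesis
  proof cases
    case 1
    have "((\<lambda>x. poly p (1 / x) * exp (- (1 / x))) has_real_derivative
            flat_exp ([:0, 0, 1:] * (p - pderiv p)) x) (at x)"
      using 1
      by (auto intro!: derivative_eq_intros DERIV_chain2[OF poly_DERIV]
               simp: flat_exp_def field_simps power2_eq_square)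
    then show ?thesis
      by (rule has_field_derivative_transform_within_open[where S = "{0<..}"])
         (use 1 in \<open>auto simp: flat_exp_def\<close>)
  next
    case 2
    have "((\<lambda>x. 0) has_real_derivative flat_exp ([:0, 0, 1:] * (p - pderiv p)) x) (at x)"
      using 2 by (auto simp: flat_exp_def)
    then show ?thesis
      by (rule has_field_derivative_transform_within_open[where S = "{..<0}"])
         (use 2 in \<open>auto simp: flat_exp_def\<close>)
  next
    case 3
    have "((\<lambda>h. poly (pCons 0 p) (inverse h) * exp (- inverse h)) \<longlongrightarrow> 0) (at_right 0)"
      by (rule filterlim_compose[OF poly_times_exp_minus_tendsto_0 filterlim_inverse_at_top_right])
    then have "((\<lambda>h. flat_exp p h / h) \<longlongrightarrow> 0) (at_right 0)"
      by (rule Lim_transform_eventually)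
         (auto simp: flat_exp_def field_simps eventually_at_filter)
    moreover have "((\<lambda>h. flat_exp p h / h) \<longlongrightarrow> 0) (at_left 0)"
      by (rule Lim_transform_eventually[OF tendsto_const])
         (auto simp: flat_exp_def eventually_at_filter)
    ultimately have "((\<lambda>h. flat_exp p h / h) \<longlongrightarrow> 0) (at 0)"
      by (rule filterlim_split_at[rotated])
    with 3 show ?thesis
      by (simp add: DERIV_def flat_exp_def)
  qed
qed

text \<open>
  Sums, products and affine substitutions are treated together because the derivative of a
  product is a sum of products: the closure of the smooth functions under all three operations
  is stable under differentiation, whereas the products alone are not.
\<close>

inductive smooth_build :: "(real \<Rightarrow> real) \<Rightarrow> bool" where
  base: "smooth f \<Longrightarrow> smooth_build f"
| add: "smooth_build f \<Longrightarrow> smooth_build g \<Longrightarrow> smooth_build (\<lambda>x. f x + g x)"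
| mult: "smooth_build f \<Longrightarrow> smooth_build g \<Longrightarrow> smooth_build (\<lambda>x. f x * g x)"
| affine: "smooth_build f \<Longrightarrow> smooth_build (\<lambda>x. f (c * x + d))"

lemma smooth_const: "smooth (\<lambda>x. c)"
  by (rule smooth_coinduct[of "\<lambda>f. \<exists>c. f = (\<lambda>x. c)"]) (auto intro!: exI[of _ "\<lambda>x. 0"])

lemma smooth_flat_exp: "smooth (flat_exp p)"
  by (rule smooth_coinduct[of "\<lambda>f. \<exists>p. f = flat_exp p"]) (blast intro: flat_exp_has_derivative)+

lemma smooth_build_imp_smooth:
  assumes "smooth_build f"
  shows "smooth f"
proof (rule smooth_coinduct[of smooth_build, OF assms])
  fix g assume "smooth_build g"
  then show "\<exists>g'. smooth_build g' \<and> (\<forall>x. (g has_real_derivative g' x) (at x))"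
  proof induction
    case (base f)
    then show ?case
      using smooth_deriv_iff smooth_build.base smooth_imp_DERIV by blast
  next
    case (add f g)
    then obtain f' g' where "smooth_build f'" "smooth_build g'"
      "\<forall>x. (f has_real_derivative f' x) (at x)" "\<forall>x. (g has_real_derivative g' x) (at x)"
      by blast
    then show ?case
      by (intro exI[of _ "\<lambda>x. f' x + g' x"]) (auto intro!: smooth_build.add derivative_intros)
  next
    case (mult f g)
    then obtain f' g' where "smooth_build f'" "smooth_build g'"
      "\<forall>x. (f has_real_derivative f' x) (at x)" "\<forall>x. (g has_real_derivative g' x) (at x)"
      by blast
    with mult.hyps show ?case
      by (intro exI[of _ "\<lambda>x. f' x * g x + g' x * f x"])
         (auto intro!: smooth_build.add smooth_build.mult derivative_intros)
  next
    case (affine f c d)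
    then obtain f' where f': "smooth_build f'" "\<forall>x. (f has_real_derivative f' x) (at x)"
      by blast
    have "smooth_build (\<lambda>x. f' (c * x + d) * c)"
      by (rule smooth_build.mult[OF smooth_build.affine[OF f'(1)] smooth_build.base[OF smooth_const]])
    moreover have "((\<lambda>x. f (c * x + d)) has_real_derivative f' (c * x + d) * c) (at x)" for x
      using f'(2) by (intro DERIV_chain2[of f]) (auto intro!: derivative_eq_intros)
    ultimately show ?case by blast
  qed
qed

lemma smooth_add: "smooth f \<Longrightarrow> smooth g \<Longrightarrow> smooth (\<lambda>x. f x + g x)"
  and smooth_mult: "smooth f \<Longrightarrow> smooth g \<Longrightarrow> smooth (\<lambda>x. f x * g x)"
  and smooth_affine: "smooth f \<Longrightarrow> smooth (\<lambda>x. f (c * x + d))"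
  by (auto intro!: smooth_build_imp_smooth intro: smooth_build.intros)

text \<open>
  The larger interval has positive length and contains \<open>K\<close> in its interior, so that
  a test function vanishes at both ends of it; integration by parts then leaves no boundary
  terms.
\<close>

lemma compact_subset_Ioo:
  fixes K :: "real set"
  assumes "compact K" "K \<subseteq> {a<..<b}" "a < b"
  obtains p q where "a < p" "p < q" "q < b" "K \<subseteq> {p<..<q}"
proof (cases "K = {}")
  case True
  show ?thesis
    by (rule that[of "(2 * a + b) / 3" "(a + 2 * b) / 3"]) (use \<open>a < b\<close> True in auto)
next
  case False
  then obtain l u where l: "l \<in> K" "\<And>x. x \<in> K \<Longrightarrow> l \<le> x" and u: "u \<in> K" "\<And>x. x \<in> K \<Longrightarrow> x \<le> u"
    using compact_attains_inf[OF assms(1)] compact_attains_sup[OF assms(1)] by metis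
  then have "a < l" "l \<le> u" "u < b" using assms(2) by auto
  then show ?thesis
    using l u by (intro that[of "(a + l) / 2" "(u + b) / 2"]) force+
qed

lemma test_functions_Ioo_iff:
  assumes "a < b"
  shows "\<phi> \<in> test_functions {a<..<b} \<longleftrightarrow>
    smooth \<phi> \<and> (\<exists>p q. a < p \<and> p < q \<and> q < b \<and> (\<forall>x. x \<notin> {p<..<q} \<longrightarrow> \<phi> x = 0))" (is "?l \<longleftrightarrow> ?r")
proof
  assume ?l
  then obtain K where K: "smooth \<phi>" "compact K" "K \<subseteq> {a<..<b}" "\<And>x. x \<notin> K \<Longrightarrow> \<phi> x = 0"
    by (auto simp: test_functions_def smooth_def)
  from compact_subset_Ioo[OF K(2,3) assms] obtain p q
    where "a < p" "p < q" "q < b" "K \<subseteq> {p<..<q}" by blast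
  then have "\<forall>x. x \<notin> {p<..<q} \<longrightarrow> \<phi> x = 0" using K(4) by blast
  with K(1) \<open>a < p\<close> \<open>p < q\<close> \<open>q < b\<close> show ?r by blast
next
  assume ?r
  then obtain p q where pq: "smooth \<phi>" "a < p" "p < q" "q < b" "\<And>x. x \<notin> {p<..<q} \<Longrightarrow> \<phi> x = 0"
    by blast
  then show ?l
    unfolding test_functions_def smooth_def
    by (auto intro!: exI[of _ "{p..q}"])
qed

text \<open>
  The product of \<open>exp (- 1 / (n (x - s)))\<close> and \<open>exp (- 1 / (n (t -
  x)))\<close> on \<open>(s, t)\<close>, extended by \<open>0\<close>. The arguments are written
  in the form \<open>c * x + d\<close> to match \<open>smooth_affine\<close>.
\<close>

definition bump :: "real \<Rightarrow> real \<Rightarrow> nat \<Rightarrow> real \<Rightarrow> real" where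
  "bump s t n x = flat_exp 1 (real n * x + (- real n * s)) * flat_exp 1 ((- real n) * x + real n * t)"

lemma smooth_bump: "smooth (bump s t n)"
  unfolding bump_def by (intro smooth_mult smooth_affine smooth_flat_exp)

lemma bump_bounds: "0 \<le> bump s t n x" "bump s t n x \<le> 1"
  by (auto simp: bump_def flat_exp_def intro!: mult_le_one)

lemma bump_eq_0: "x \<notin> {s<..<t} \<Longrightarrow> bump s t n x = 0"
proof -
  assume "x \<notin> {s<..<t}"
  then have "x - s \<le> 0 \<or> t - x \<le> 0" by auto
  then have "real n * (x - s) \<le> 0 \<or> real n * (t - x) \<le> 0"
    by (meson mult_nonneg_nonpos of_nat_0_le_iff)
  then show ?thesis
    by (auto simp: bump_def flat_exp_def algebra_simps)
qed

lemma bump_tendsto_indicator: "(\<lambda>n. bump s t n x) \<longlonglongrightarrow> indicator {s<..<t} x"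
proof (cases "x \<in> {s<..<t}")
  case True
  then have "(\<lambda>n. exp (- (1 / (x - s) * (1 / real n))) * exp (- (1 / (t - x) * (1 / real n))))
      \<longlonglongrightarrow> exp (- (1 / (x - s) * 0)) * exp (- (1 / (t - x) * 0))"
    by (intro tendsto_intros lim_1_over_n)
  moreover have "\<forall>\<^sub>F n in sequentially.
      exp (- (1 / (x - s) * (1 / real n))) * exp (- (1 / (t - x) * (1 / real n))) = bump s t n x"
    using eventually_gt_at_top[of 0]
  proof eventually_elim
    case (elim n)
    have "real n * x + - real n * s = real n * (x - s)" "- real n * x + real n * t = real n * (t - x)"
      by (auto simp: algebra_simps)
    with elim True show ?case
      by (simp add: bump_def flat_exp_def mult.commute)
  qed
  ultimately show ?thesis
    using True by (auto intro: Lim_transform_eventually)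
next
  case False
  then show ?thesis by (simp add: bump_eq_0)
qed

lemma bump_in_test_functions:
  assumes "a < s" "s < t" "t < b"
  shows "bump s t n \<in> test_functions {a<..<b}"
proof -
  have "a < b" using assms by linarith
  then show ?thesis
    using assms bump_eq_0[of _ s t n] smooth_bump[of s t n]
    by (subst test_functions_Ioo_iff) blast+
qed

section \<open>The fundamental lemma of the calculus of variations\<close>

text \<open>
  The densities given by the positive and the negative part of \<open>h\<close> define finite
  measures that agree on all rays, hence everywhere; so the two parts agree almost everywhere,
  and both vanish.
\<close>

lemma lborel_AE_eq_0_if_ray_integrals_eq_0:
  fixes h :: "real \<Rightarrow> real"
  assumes h: "integrable lborel h"
    and 0: "\<And>x. (LINT y:{x<..}|lborel. h y) = 0"
  shows "AE x in lborel. h x = 0"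
proof -
  have [measurable]: "h \<in> borel_measurable borel" using h by auto
  define P where "P x = max 0 (h x)" for x
  define N where "N x = max 0 (- h x)" for x
  have [measurable]: "P \<in> borel_measurable borel" "N \<in> borel_measurable borel"
    unfolding P_def N_def by measurable
  have PN: "\<And>x. 0 \<le> P x" "\<And>x. 0 \<le> N x" "\<And>x. h x = P x - N x"
    by (auto simp: P_def N_def)
  have int: "integrable lborel P" "integrable lborel N"
    unfolding P_def N_def using h by simp_all
  have em: "emeasure (density lborel (\<lambda>x. ennreal (R x))) {y<..} = ennreal (LINT x:{y<..}|lborel. R x)"
    if R: "integrable lborel R" "\<And>x. 0 \<le> R x" for R and y :: real
  proof -
    have [measurable]: "R \<in> borel_measurable borel" using R by auto
    have "emeasure (density lborel (\<lambda>x. ennreal (R x))) {y<..} = (\<integral>\<^sup>+x. ennreal (R x) * indicator {y<..} x \<partial>lborel)"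
      by (subst emeasure_density) auto
    also have "\<dots> = (\<integral>\<^sup>+x. ennreal (indicator {y<..} x *\<^sub>R R x) \<partial>lborel)"
      by (intro nn_integral_cong) (auto split: split_indicator)
    also have "\<dots> = ennreal (LINT x:{y<..}|lborel. R x)"
      unfolding set_lebesgue_integral_def
      by (intro nn_integral_eq_integral integrable_mult_indicator R) (auto simp: R)
    finally show ?thesis .
  qed
  have eq: "(LINT x:{y<..}|lborel. P x) = (LINT x:{y<..}|lborel. N x)" for y
  proof -
    have "set_integrable lborel {y<..} P" "set_integrable lborel {y<..} N"
      unfolding set_integrable_def by (intro integrable_mult_indicator int; simp)+
    then have "(LINT x:{y<..}|lborel. P x - N x) = (LINT x:{y<..}|lborel. P x) - (LINT x:{y<..}|lborel. N x)"
      by (rule set_integral_diff(2))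
    with 0[of y] show ?thesis by (simp add: PN(3))
  qed
  have "density lborel (\<lambda>x. ennreal (P x)) = density lborel (\<lambda>x. ennreal (N x))"
    by (rule measure_eqI_lessThan) (simp_all add: em int PN eq)
  then have "AE x in lborel. ennreal (P x) = ennreal (N x)"
    by (intro sigma_finite_measure.density_unique[OF lborel.sigma_finite_measure_axioms]) auto
  then show ?thesis
    by eventually_elim (simp add: PN)
qed

text \<open>
  Intervals with rational endpoints suffice to cover the open interval, and there are only
  countably many of them.
\<close>

lemma AE_Ioo_if_AE_Icc:
  fixes a b :: real
  assumes "\<And>s t. a < s \<Longrightarrow> s < t \<Longrightarrow> t < b \<Longrightarrow> AE x in M. x \<in> {s..t} \<longrightarrow> P x"
  shows "AE x in M. x \<in> {a<..<b} \<longrightarrow> P x"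
proof -
  have "AE x in M. \<forall>s\<in>\<rat>. \<forall>t\<in>\<rat>. a < s \<longrightarrow> s < t \<longrightarrow> t < b \<longrightarrow> x \<in> {s..t} \<longrightarrow> P x"
    using assms by (intro AE_ball_countable' countable_rat) (auto intro!: AE_impI)
  then show ?thesis
  proof eventually_elim
    case (elim x)
    show ?case
    proof
      assume "x \<in> {a<..<b}"
      then obtain s t where "s \<in> \<rat>" "a < s" "s < x" "t \<in> \<rat>" "x < t" "t < b"
        using Rats_dense_in_real[of a x] Rats_dense_in_real[of x b] by auto
      with elim show "P x" by auto
    qed
  qed
qed

lemma bounded_if_compact_support:
  assumes "continuous_on UNIV \<phi>" "\<And>x. x \<notin> {p<..<q} \<Longrightarrow> \<phi> x = (0::real)"
  obtains B where "\<And>x::real. \<bar>\<phi> x\<bar> \<le> B"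
proof -
  have "compact (\<phi> ` {p..q})"
    by (intro compact_continuous_image) (auto intro: continuous_on_subset[OF assms(1)])
  then obtain B where B: "\<And>x. x \<in> {p..q} \<Longrightarrow> \<bar>\<phi> x\<bar> \<le> B"
    using compact_imp_bounded bounded_iff[of "\<phi> ` {p..q}"] by (metis imageI real_norm_def)
  have "\<bar>\<phi> x\<bar> \<le> max B 0" for x
    by (cases "x \<in> {p<..<q}") (use B[of x] assms(2)[of x] in auto)
  then show ?thesis using that by blast
qed

lemma borel_measurable_lebesgue_continuous:
  fixes f :: "real \<Rightarrow> real"
  shows "continuous_on UNIV f \<Longrightarrow> f \<in> borel_measurable lebesgue"
  by (intro measurable_completion) (simp add: borel_measurable_continuous_onI)

lemma locally_integrable_onD:
  "u locally_integrable_on S \<Longrightarrow> {p..q} \<subseteq> S \<Longrightarrow> integrable lebesgue (\<lambda>x. indicator {p..q} x * u x)"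
  by (simp add: locally_integrable_on_def set_integrable_def)

lemma set_integrable_mult_compact_support:
  assumes u: "u locally_integrable_on {a<..<b}"
    and \<phi>: "continuous_on UNIV \<phi>" "\<And>x. x \<notin> {p<..<q} \<Longrightarrow> \<phi> x = 0"
    and pq: "a < p" "p < q" "q < b"
  shows "set_integrable lebesgue {a<..<b} (\<lambda>x. u x * \<phi> x)"
proof -
  obtain B where B: "\<And>x. \<bar>\<phi> x\<bar> \<le> B" using bounded_if_compact_support[OF \<phi>] by blast
  have up: "integrable lebesgue (\<lambda>x. indicator {p..q} x * u x)"
    by (rule locally_integrable_onD[OF u]) (use pq in auto)
  have [measurable]: "\<phi> \<in> borel_measurable lebesgue"
    by (rule borel_measurable_lebesgue_continuous[OF \<phi>(1)])
  have "integrable lebesgue (\<lambda>x. (indicator {p..q} x * u x) * \<phi> x)"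
  proof (rule Bochner_Integration.integrable_bound[OF integrable_mult_left[OF up, of B]])
    show "(\<lambda>x. (indicator {p..q} x * u x) * \<phi> x) \<in> borel_measurable lebesgue"
      by (intro borel_measurable_times[OF borel_measurable_integrable[OF up]]) measurable
    show "AE x in lebesgue. norm ((indicator {p..q} x * u x) * \<phi> x) \<le> norm (indicator {p..q} x * u x * B)"
    proof (intro AE_I2)
      fix x
      have "\<bar>\<phi> x\<bar> \<le> \<bar>B\<bar>" using B[of x] by linarith
      then show "norm ((indicator {p..q} x * u x) * \<phi> x) \<le> norm (indicator {p..q} x * u x * B)"
        by (simp add: abs_mult mult_left_mono)
    qed
  qed
  also have "(\<lambda>x. (indicator {p..q} x * u x) * \<phi> x) = (\<lambda>x. indicator {a<..<b} x *\<^sub>R (u x * \<phi> x))"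
    using pq \<phi>(2) by (fastforce split: split_indicator)
  finally show ?thesis by (simp add: set_integrable_def)
qed

lemma set_integrable_mult_test_function:
  assumes u: "u locally_integrable_on {a<..<b}" and "a < b" "\<phi> \<in> test_functions {a<..<b}"
  shows "set_integrable lebesgue {a<..<b} (\<lambda>x. u x * \<phi> x)"
    and "set_integrable lebesgue {a<..<b} (\<lambda>x. u x * deriv \<phi> x)"
proof -
  obtain p q where pq: "smooth \<phi>" "a < p" "p < q" "q < b" "\<And>x. x \<notin> {p<..<q} \<Longrightarrow> \<phi> x = 0"
    using assms by (auto simp: test_functions_Ioo_iff)
  show "set_integrable lebesgue {a<..<b} (\<lambda>x. u x * \<phi> x)"
    using pq by (intro set_integrable_mult_compact_support[OF u]) (auto intro: smooth_imp_continuous_on)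
  obtain p' q' where pq': "a < p'" "p' < p" "q < q'" "q' < b"
    using pq dense by metis
  have "deriv \<phi> x = 0" if x: "x \<notin> {p'<..<q'}" for x
  proof -
    have "((\<lambda>x. 0) has_real_derivative 0) (at x)" by simp
    then have "(\<phi> has_real_derivative 0) (at x)"
      by (rule has_field_derivative_transform_within_open[where S = "- {p..q}"])
         (use x pq pq' in auto)
    then show ?thesis by (rule DERIV_imp_deriv)
  qed
  then show "set_integrable lebesgue {a<..<b} (\<lambda>x. u x * deriv \<phi> x)"
    using pq pq' smooth_deriv_iff[of \<phi>]
    by (intro set_integrable_mult_compact_support[OF u, of _ p' q']) (auto intro: smooth_imp_continuous_on)
qed

text \<open>
  The bump functions on \<open>(s, t)\<close> converge to its indicator and are bounded by
  \<open>1\<close>, so dominated convergence applies.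
\<close>

lemma fundamental_lemma_interval:
  assumes h: "h locally_integrable_on {a<..<b}"
    and 0: "\<And>\<phi>. \<phi> \<in> test_functions {a<..<b} \<Longrightarrow> (LINT x:{a<..<b}|lebesgue. h x * \<phi> x) = 0"
    and st: "a < s" "s < t" "t < b"
  shows "(LINT x:{s..t}|lebesgue. h x) = 0"
proof -
  have hst: "integrable lebesgue (\<lambda>x. indicator {s..t} x * h x)"
    by (rule locally_integrable_onD[OF h]) (use st in auto)
  note [measurable] = borel_measurable_integrable[OF hst]
  have "(\<lambda>n. LINT x|lebesgue. (indicator {s..t} x * h x) * bump s t n x)
      \<longlonglongrightarrow> (LINT x|lebesgue. (indicator {s..t} x * h x) * indicator {s<..<t} x)"
  proof (rule integral_dominated_convergence[where w = "\<lambda>x. norm (indicator {s..t} x * h x)"])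
    show "(\<lambda>x. (indicator {s..t} x * h x) * bump s t n x) \<in> borel_measurable lebesgue" for n
      by (intro borel_measurable_times[OF borel_measurable_integrable[OF hst]]
            borel_measurable_lebesgue_continuous smooth_imp_continuous_on smooth_bump)
    show "AE x in lebesgue. (\<lambda>n. (indicator {s..t} x * h x) * bump s t n x)
            \<longlonglongrightarrow> (indicator {s..t} x * h x) * indicator {s<..<t} x"
      by (intro AE_I2 tendsto_intros bump_tendsto_indicator)
    show "AE x in lebesgue. norm ((indicator {s..t} x * h x) * bump s t n x) \<le> norm (indicator {s..t} x * h x)" for n
      using bump_bounds[of s t n]
      by (intro AE_I2) (auto simp: abs_mult intro!: mult_right_le_one_le mult_nonneg_nonneg)
    show "(\<lambda>x. indicator {s..t} x * h x * indicator {s<..<t} x) \<in> borel_measurable lebesgue"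
      by (intro borel_measurable_times[OF borel_measurable_integrable[OF hst]] measurable_completion) simp
  qed (use hst in auto)
  moreover have "(LINT x|lebesgue. (indicator {s..t} x * h x) * bump s t n x) = 0" for n
  proof -
    have "(\<lambda>x. (indicator {s..t} x * h x) * bump s t n x) = (\<lambda>x. indicator {a<..<b} x *\<^sub>R (h x * bump s t n x))"
      using st bump_eq_0[of _ s t n] by (fastforce split: split_indicator)
    then show ?thesis
      using 0[OF bump_in_test_functions[OF st]] by (simp add: set_lebesgue_integral_def)
  qed
  moreover have "(LINT x|lebesgue. (indicator {s..t} x * h x) * indicator {s<..<t} x) = (LINT x:{s..t}|lebesgue. h x)"
    unfolding set_lebesgue_integral_def
  proof (rule integral_cong_AE)
    have "AE x in lborel. x \<noteq> s" "AE x in lborel. x \<noteq> t" by (auto intro: AE_lborel_singleton)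
    then have "AE x in lebesgue. x \<noteq> s" "AE x in lebesgue. x \<noteq> t"
      by (auto intro: AE_completion)
    then show "AE x in lebesgue. indicator {s..t} x * h x * indicator {s<..<t} x = indicator {s..t} x *\<^sub>R h x"
      by eventually_elim (auto split: split_indicator)
  next
    show "(\<lambda>x. indicator {s..t} x * h x * indicator {s<..<t} x) \<in> borel_measurable lebesgue"
      by (intro borel_measurable_times[OF borel_measurable_integrable[OF hst]] measurable_completion) simp
    show "(\<lambda>x. indicator {s..t} x *\<^sub>R h x) \<in> borel_measurable lebesgue"
      using borel_measurable_integrable[OF hst] by simp
  qed
  ultimately show ?thesis by (simp add: LIMSEQ_const_iff)
qed

text \<open>
  On each compact subinterval \<open>h\<close> is integrable, and its integrals over rays are
  integrals over subintervals, which vanish.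
\<close>

lemma fundamental_lemma_calculus_of_variations:
  assumes h: "h locally_integrable_on {a<..<b}"
    and 0: "\<And>\<phi>. \<phi> \<in> test_functions {a<..<b} \<Longrightarrow> (LINT x:{a<..<b}|lebesgue. h x * \<phi> x) = 0"
  shows "AE x in lebesgue. x \<in> {a<..<b} \<longrightarrow> h x = 0"
proof (rule AE_Ioo_if_AE_Icc)
  fix s t assume st: "a < s" "s < t" "t < b"
  have hst: "integrable lebesgue (\<lambda>x. indicator {s..t} x * h x)"
    by (rule locally_integrable_onD[OF h]) (use st in auto)
  obtain h' where h': "h' \<in> borel_measurable lborel" "AE x in lborel. indicator {s..t} x * h x = h' x"
    using completion_ex_borel_measurable_real[OF borel_measurable_integrable[OF hst]] by blast
  have AE': "AE x in lebesgue. h' x = indicator {s..t} x * h x"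
    using AE_completion[OF h'(2)] by eventually_elim simp
  have h'm: "h' \<in> borel_measurable lebesgue" by (rule measurable_completion[OF h'(1)])
  have "integrable lebesgue h'"
    using hst integrable_cong_AE[OF h'm borel_measurable_integrable[OF hst] AE'] by blast
  then have int: "integrable lborel h'"
    using h'(1) by (simp add: integrable_completion)
  have "(LINT y:{x<..}|lborel. h' y) = 0" for x
  proof -
    have "(LINT y:{x<..}|lborel. h' y) = (LINT y:{x<..}|lebesgue. h' y)"
      unfolding set_lebesgue_integral_def using h'(1)
      by (intro integral_completion[symmetric]) auto
    also have "\<dots> = (LINT y:{max s x..t}|lebesgue. h y)"
      unfolding set_lebesgue_integral_def
    proof (rule integral_cong_AE)
      have "AE y in lborel. y \<noteq> x" by (rule AE_lborel_singleton)
      then have "AE y in lebesgue. y \<noteq> x" by (rule AE_completion)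
      with AE' show "AE y in lebesgue. indicator {x<..} y *\<^sub>R h' y = indicator {max s x..t} y *\<^sub>R h y"
        by eventually_elim (auto split: split_indicator)
      have "(\<lambda>y. indicator {max s x..t} y *\<^sub>R h y) = (\<lambda>y. indicator {x..} y * (indicator {s..t} y * h y))"
        by (auto split: split_indicator)
      then show "(\<lambda>y. indicator {max s x..t} y *\<^sub>R h y) \<in> borel_measurable lebesgue"
        by (simp only:) (intro borel_measurable_times[OF _ borel_measurable_integrable[OF hst]] measurable_completion, simp)
      show "(\<lambda>y. indicator {x<..} y *\<^sub>R h' y) \<in> borel_measurable lebesgue"
        using h'(1) by (intro measurable_completion) simp
    qed
    also have "\<dots> = 0"
    proof (cases "max s x < t")
      case True
      then show ?thesis by (intro fundamental_lemma_interval[OF h 0]) (use st in auto)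
    next
      case False
      then have "{max s x..t} = (if max s x = t then {t} else {})" by auto
      moreover have "AE y in lebesgue. y \<noteq> t" by (intro AE_completion AE_lborel_singleton)
      then have "(LINT y|lebesgue. indicator {t} y * h y) = 0"
        by (intro integral_eq_zero_AE) (erule eventually_mono, simp)
      ultimately show ?thesis by (auto simp: set_lebesgue_integral_def)
    qed
    finally show ?thesis .
  qed
  then have "AE x in lborel. h' x = 0"
    by (rule lborel_AE_eq_0_if_ray_integrals_eq_0[OF int])
  then have "AE x in lebesgue. h' x = 0" by (rule AE_completion)
  with AE' show "AE x in lebesgue. x \<in> {s..t} \<longrightarrow> h x = 0"
    by eventually_elim auto
qed

lemma locally_integrable_on_diff:
  assumes "f locally_integrable_on S" "g locally_integrable_on S"
  shows "(\<lambda>x. f x - g x) locally_integrable_on S"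
  using assms unfolding locally_integrable_on_def by (auto intro: set_integral_diff(1))

lemma weak_derivative_unique:
  assumes "has_weak_derivative_on f g {a<..<b}" "has_weak_derivative_on f h {a<..<b}" "a < b"
  shows "AE x in lebesgue. x \<in> {a<..<b} \<longrightarrow> g x = h x"
proof -
  have li: "g locally_integrable_on {a<..<b}" "h locally_integrable_on {a<..<b}"
    using assms by (auto simp: has_weak_derivative_on_def)
  have "AE x in lebesgue. x \<in> {a<..<b} \<longrightarrow> g x - h x = 0"
  proof (rule fundamental_lemma_calculus_of_variations)
    show "(\<lambda>x. g x - h x) locally_integrable_on {a<..<b}"
      by (rule locally_integrable_on_diff[OF li])
    fix \<phi> assume \<phi>: "\<phi> \<in> test_functions {a<..<b}"
    have "- (LINT x:{a<..<b}|lebesgue. g x * \<phi> x) = - (LINT x:{a<..<b}|lebesgue. h x * \<phi> x)"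
      using assms(1,2) \<phi> unfolding has_weak_derivative_on_def by simp
    then show "(LINT x:{a<..<b}|lebesgue. (g x - h x) * \<phi> x) = 0"
      using set_integral_diff(2)[OF set_integrable_mult_test_function(1)[OF li(1) \<open>a < b\<close> \<phi>]
          set_integrable_mult_test_function(1)[OF li(2) \<open>a < b\<close> \<phi>]]
      by (simp add: left_diff_distrib)
  qed
  then show ?thesis by eventually_elim auto
qed

section \<open>Weakly differentiable functions as primitives\<close>

lemma set_integrable_Icc_D:
  "u locally_integrable_on S \<Longrightarrow> {p..q} \<subseteq> S \<Longrightarrow> set_integrable lebesgue {p..q} u"
  by (simp add: locally_integrable_on_def)

text \<open>
  The antiderivative that vanishes to the left of the support is constant to the right of it;
  the constant is the integral of the given function. Only for integral \<open>0\<close> is the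
  support compact again.
\<close>

lemma test_function_antiderivative:
  assumes \<xi>: "\<xi> \<in> test_functions {a<..<b}" and "a < b"
    and 0: "(LINT x:{a<..<b}|lebesgue. \<xi> x) = 0"
  shows "\<exists>\<Phi> \<in> test_functions {a<..<b}. deriv \<Phi> = \<xi>"
proof -
  obtain p q where pq: "smooth \<xi>" "a < p" "p < q" "q < b" "\<And>x. x \<notin> {p<..<q} \<Longrightarrow> \<xi> x = 0"
    using \<xi> \<open>a < b\<close> by (auto simp: test_functions_Ioo_iff)
  have cont: "continuous_on S \<xi>" for S by (rule smooth_imp_continuous_on[OF pq(1)])
  have isC: "isCont \<xi> x" for x
    using cont[of UNIV] by (simp add: continuous_on_eq_continuous_at)
  obtain F where F: "\<And>x. (F has_real_derivative \<xi> x) (at x)"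
    using einterval_antiderivative[of "-\<infinity>" "\<infinity>" \<xi>] isC
    by (auto simp: has_real_derivative_iff_has_vector_derivative)
  define \<Phi> where "\<Phi> x = F x - F p" for x
  have \<Phi>: "(\<Phi> has_real_derivative \<xi> x) (at x)" for x
    unfolding \<Phi>_def using F[of x] by (auto intro!: derivative_eq_intros)
  have dPhi: "deriv \<Phi> = \<xi>"
    using \<Phi> by (auto intro!: DERIV_imp_deriv)
  then have "smooth \<Phi>"
    using \<Phi> pq(1) by (subst smooth_deriv_iff) (auto simp: field_differentiable_def)
  have left: "F x = F p" if "x \<le> p" for x
  proof (cases "x = p")
    case False
    then have "\<exists>z>x. z < p \<and> F p - F x = (p - x) * \<xi> z"
      using that F by (intro MVT2) auto
    then show ?thesis using pq(5) by auto
  qed simp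
  have right: "F x = F q" if "q \<le> x" for x
  proof (cases "x = q")
    case False
    then have "\<exists>z>q. z < x \<and> F x - F q = (x - q) * \<xi> z"
      using that F by (intro MVT2) auto
    then show ?thesis using pq(5) by auto
  qed simp
  have "(LINT x:{a<..<b}|lebesgue. \<xi> x) = (LINT x:{p..q}|lebesgue. \<xi> x)"
    unfolding set_lebesgue_integral_def
    by (intro Bochner_Integration.integral_cong refl) (use pq in \<open>auto split: split_indicator\<close>)
  also have "\<dots> = integral {p..q} \<xi>"
    by (intro set_lebesgue_integral_eq_integral absolutely_integrable_continuous_real cont)
  also have "\<dots> = F q - F p"
    using pq F
    by (intro integral_unique fundamental_theorem_of_calculus)
       (auto simp: has_real_derivative_iff_has_vector_derivative[symmetric] intro: has_field_derivative_at_within)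
  finally have "F q = F p" using 0 by simp
  then have "\<Phi> x = 0" if "x \<notin> {p<..<q}" for x
    using that left[of x] right[of x] by (auto simp: \<Phi>_def)
  with \<open>smooth \<Phi>\<close> pq \<open>a < b\<close> have "\<Phi> \<in> test_functions {a<..<b}"
    by (subst test_functions_Ioo_iff) blast+
  with dPhi show ?thesis by blast
qed

lemma continuous_locally_integrable:
  assumes "continuous_on {a<..<b} u" "a < b"
  shows "u locally_integrable_on {a<..<b}"
  unfolding locally_integrable_on_def
proof (intro allI impI)
  fix K assume K: "compact K \<and> K \<subseteq> {a<..<b}"
  then obtain p q where pq: "a < p" "p < q" "q < b" "K \<subseteq> {p<..<q}"
    using compact_subset_Ioo[of K a b] \<open>a < b\<close> by metis
  have "set_integrable lebesgue {p..q} u"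
    by (intro absolutely_integrable_continuous_real continuous_on_subset[OF assms(1)]) (use pq in auto)
  moreover have "K \<in> sets lebesgue" using K by (simp add: compact_imp_closed lmeasurable_compact fmeasurableD)
  ultimately show "set_integrable lebesgue K u"
    using pq by (rule_tac set_integrable_subset[of _ "{p..q}"]) auto
qed

lemma test_function_linear_combination:
  assumes "\<phi> \<in> test_functions {a<..<b}" "\<psi> \<in> test_functions {a<..<b}" "a < b"
  shows "(\<lambda>x. \<phi> x + c * \<psi> x) \<in> test_functions {a<..<b}"
proof -
  obtain p q where pq: "smooth \<phi>" "a < p" "p < q" "q < b" "\<And>x. x \<notin> {p<..<q} \<Longrightarrow> \<phi> x = 0"
    using assms by (auto simp: test_functions_Ioo_iff)
  obtain p' q' where pq': "smooth \<psi>" "a < p'" "p' < q'" "q' < b" "\<And>x. x \<notin> {p'<..<q'} \<Longrightarrow> \<psi> x = 0"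
    using assms by (auto simp: test_functions_Ioo_iff)
  have "smooth (\<lambda>x. \<phi> x + c * \<psi> x)"
    by (intro smooth_add smooth_mult smooth_const pq pq')
  moreover have "\<phi> x + c * \<psi> x = 0" if "x \<notin> {min p p'<..<max q q'}" for x
    using that pq(5)[of x] pq'(5)[of x] by (cases "x \<le> p"; cases "x \<le> p'"; cases "q \<le> x"; cases "q' \<le> x") auto
  moreover have "a < min p p'" "min p p' < max q q'" "max q q' < b"
    using pq pq' by auto
  ultimately show ?thesis
    using \<open>a < b\<close> by (subst test_functions_Ioo_iff) blast+
qed

text \<open>
  With a test function \<open>\<eta>\<close> of nonzero integral, every test function is the sum
  of a multiple of \<open>\<eta>\<close> and a test function of integral \<open>0\<close>, that
  is, a derivative. Hence \<open>u\<close> integrates against every test function like the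
  constant \<open>\<integral>u\<eta> / \<integral>\<eta>\<close>.
\<close>

lemma weakly_constant_imp_constant:
  assumes u: "u locally_integrable_on {a<..<b}" and "a < b"
    and 0: "\<And>\<phi>. \<phi> \<in> test_functions {a<..<b} \<Longrightarrow> (LINT x:{a<..<b}|lebesgue. u x * deriv \<phi> x) = 0"
  shows "\<exists>C. AE x in lebesgue. x \<in> {a<..<b} \<longrightarrow> u x = C"
proof -
  define s where "s = (2 * a + b) / 3"
  define t where "t = (a + 2 * b) / 3"
  have st: "a < s" "s < t" "t < b" using \<open>a < b\<close> by (auto simp: s_def t_def)
  have one: "(\<lambda>x. 1) locally_integrable_on {a<..<b}"
    by (intro continuous_locally_integrable \<open>a < b\<close> continuous_intros)
  have int1: "set_integrable lebesgue {a<..<b} \<phi>" if "\<phi> \<in> test_functions {a<..<b}" for \<phi>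
    using set_integrable_mult_test_function(1)[OF one \<open>a < b\<close> that] by simp
  note intu = set_integrable_mult_test_function(1)[OF u \<open>a < b\<close>]
  obtain \<eta> where \<eta>: "\<eta> \<in> test_functions {a<..<b}" and m: "(LINT x:{a<..<b}|lebesgue. \<eta> x) \<noteq> 0"
  proof -
    have "\<not> (\<forall>\<eta>\<in>test_functions {a<..<b}. (LINT x:{a<..<b}|lebesgue. 1 * \<eta> x) = 0)"
    proof
      assume "\<forall>\<eta>\<in>test_functions {a<..<b}. (LINT x:{a<..<b}|lebesgue. 1 * \<eta> x) = 0"
      then have "(LINT x:{s..t}|lebesgue. (1::real)) = 0"
        by (intro fundamental_lemma_interval[OF one _ st]) blast
      with st show False by (simp add: set_lebesgue_integral_def)
    qed
    then show ?thesis using that by auto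
  qed
  define C where "C = (LINT x:{a<..<b}|lebesgue. u x * \<eta> x) / (LINT x:{a<..<b}|lebesgue. \<eta> x)"
  have "AE x in lebesgue. x \<in> {a<..<b} \<longrightarrow> u x - C = 0"
  proof (rule fundamental_lemma_calculus_of_variations)
    have "(\<lambda>x. C) locally_integrable_on {a<..<b}"
      by (intro continuous_locally_integrable \<open>a < b\<close> continuous_intros)
    then show "(\<lambda>x. u x - C) locally_integrable_on {a<..<b}"
      by (rule locally_integrable_on_diff[OF u])
    fix \<psi> assume \<psi>: "\<psi> \<in> test_functions {a<..<b}"
    \<comment> \<open>chosen so that \<open>\<psi> + c \<eta>\<close> has integral \<open>0\<close>\<close>
    define c where "c = - (LINT x:{a<..<b}|lebesgue. \<psi> x) / (LINT x:{a<..<b}|lebesgue. \<eta> x)"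
    have \<xi>: "(\<lambda>x. \<psi> x + c * \<eta> x) \<in> test_functions {a<..<b}"
      by (intro test_function_linear_combination \<psi> \<eta> \<open>a < b\<close>)
    have "(LINT x:{a<..<b}|lebesgue. \<psi> x + c * \<eta> x) = 0"
      using m by (simp add: set_integral_add(2) int1 \<psi> \<eta> set_integrable_mult_right c_def)
    then obtain \<Phi> where \<Phi>: "\<Phi> \<in> test_functions {a<..<b}" "deriv \<Phi> = (\<lambda>x. \<psi> x + c * \<eta> x)"
      using test_function_antiderivative[OF \<xi> \<open>a < b\<close>] by blast
    have "0 = (LINT x:{a<..<b}|lebesgue. u x * \<psi> x + c * (u x * \<eta> x))"
      using 0[OF \<Phi>(1)] by (simp add: \<Phi>(2) algebra_simps)
    also have "\<dots> = (LINT x:{a<..<b}|lebesgue. u x * \<psi> x) + c * (LINT x:{a<..<b}|lebesgue. u x * \<eta> x)"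
      by (simp add: set_integral_add(2) intu \<psi> \<eta> set_integrable_mult_right)
    also have "\<dots> = (LINT x:{a<..<b}|lebesgue. u x * \<psi> x) - C * (LINT x:{a<..<b}|lebesgue. \<psi> x)"
      by (simp add: c_def C_def)
    also have "\<dots> = (LINT x:{a<..<b}|lebesgue. u x * \<psi> x - C * \<psi> x)"
      by (simp add: set_integral_diff(2) intu int1 \<psi> set_integrable_mult_right)
    finally show "(LINT x:{a<..<b}|lebesgue. (u x - C) * \<psi> x) = 0"
      by (simp add: left_diff_distrib)
  qed
  then show ?thesis by (intro exI[of _ C]) (erule eventually_mono, simp)
qed

text \<open>
  The exchange of integrals over the triangle \<open>y \<le> x\<close> that replaces integration
  by parts for a primitive which is differentiable only almost everywhere.
\<close>

lemma iterated_integral_triangle: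
  fixes g D :: "real \<Rightarrow> real"
  assumes g: "integrable lborel g" and D: "integrable lborel D"
  shows "(LINT x|lborel. (LINT y:{..x}|lborel. g y) * D x) = (LINT y|lborel. g y * (LINT x:{y..}|lborel. D x))"
proof -
  have [measurable]: "g \<in> borel_measurable borel" "D \<in> borel_measurable borel"
    using g D by auto
  define k where "k x y = (if y \<le> x then g y * D x else 0)" for x y
  have [measurable]: "case_prod k \<in> borel_measurable (lborel \<Otimes>\<^sub>M lborel)"
    unfolding k_def by measurable
  have "integrable (lborel \<Otimes>\<^sub>M lborel) (\<lambda>(x, y). g y * D x)"
  proof (rule lborel_pair.Fubini_integrable)
    show "integrable lborel (\<lambda>x. LINT y|lborel. norm (case (x, y) of (x, y) \<Rightarrow> g y * D x))"
      using D by (simp add: abs_mult)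
  qed (use g in auto)
  then have "integrable (lborel \<Otimes>\<^sub>M lborel) (case_prod k)"
    by (rule Bochner_Integration.integrable_bound) (auto simp: k_def)
  from lborel_pair.Fubini_integral[OF this]
  have "(LINT y|lborel. LINT x|lborel. k x y) = (LINT x|lborel. LINT y|lborel. k x y)" .
  moreover have "(LINT x|lborel. k x y) = g y * (LINT x:{y..}|lborel. D x)" for y
  proof -
    have "(LINT x|lborel. k x y) = (LINT x|lborel. g y * (indicator {y..} x *\<^sub>R D x))"
      by (intro Bochner_Integration.integral_cong) (auto simp: k_def split: split_indicator)
    then show ?thesis by (simp add: set_lebesgue_integral_def)
  qed
  moreover have "(LINT y|lborel. k x y) = (LINT y:{..x}|lborel. g y) * D x" for x
  proof -
    have "(LINT y|lborel. k x y) = (LINT y|lborel. (indicator {..x} y *\<^sub>R g y) * D x)"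
      by (intro Bochner_Integration.integral_cong) (auto simp: k_def split: split_indicator)
    then show ?thesis by (simp add: set_lebesgue_integral_def)
  qed
  ultimately show ?thesis by simp
qed


text \<open>
  Prescribing the increments, in Lebesgue's sense, avoids the choice of a base point and
  expresses absolute continuity without pointwise derivatives.
\<close>

definition is_primitive_on :: "(real \<Rightarrow> real) \<Rightarrow> (real \<Rightarrow> real) \<Rightarrow> real set \<Rightarrow> bool" where
  "is_primitive_on F g S \<longleftrightarrow> (\<forall>x\<in>S. \<forall>y\<in>S. x \<le> y \<longrightarrow> F y - F x = (LINT t:{x..y}|lebesgue. g t))"

lemma primitive_exists:
  assumes g: "g locally_integrable_on {a<..<b}"
  shows "\<exists>F. is_primitive_on F g {a<..<b}"
proof -
  define m where "m = (a + b) / 2"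
  define F where "F x = integral {m..x} g - integral {x..m} g" for x
  have int: "g integrable_on {x..y}" "(LINT t:{x..y}|lebesgue. g t) = integral {x..y} g"
    if "a < x" "y < b" for x y
    by (intro set_lebesgue_integral_eq_integral set_integrable_Icc_D[OF g]; use that in auto)+
  have "F y - F x = integral {x..y} g" if xy: "a < x" "x \<le> y" "y < b" for x y
  proof -
    have m: "a < m" "m < b" using xy by (auto simp: m_def)
    have comb: "integral {u..v} g + integral {v..w} g = integral {u..w} g"
      if "a < u" "u \<le> v" "v \<le> w" "w < b" for u v w
      using that by (intro Henstock_Kurzweil_Integration.integral_combine int) auto
    have triv: "integral {u..v} g = 0" if "v \<le> u" for u v
      using that by (cases "u = v") auto
    consider "m \<le> x" | "x < m" "m \<le> y" | "y < m" by linarith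
    then show ?thesis
    proof cases
      case 1 then show ?thesis
        using xy m comb[of m x y] triv[where u = x and v = m] triv[where u = y and v = m] by (simp add: F_def)
    next
      case 2 then show ?thesis
        using xy m comb[of x m y] triv[where u = m and v = x] triv[where u = y and v = m] by (simp add: F_def)
    next
      case 3 then show ?thesis
        using xy m comb[of x y m] triv[where u = m and v = x] triv[where u = m and v = y] by (simp add: F_def)
    qed
  qed
  then show ?thesis
    using int by (intro exI[of _ F]) (auto simp: is_primitive_on_def)
qed

lemma primitive_continuous_on:
  assumes g: "g locally_integrable_on {a<..<b}" and F: "is_primitive_on F g {a<..<b}"
  shows "continuous_on {a<..<b} F"
proof (rule continuous_at_imp_continuous_on, rule ballI)
  fix x assume x: "x \<in> {a<..<b}"
  obtain p q where pq: "a < p" "p < x" "x < q" "q < b"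
    using x dense[of a x] dense[of x b] by auto
  have gi: "set_integrable lebesgue {p..q} g"
    by (rule set_integrable_Icc_D[OF g]) (use pq in auto)
  have "continuous_on {p..q} (\<lambda>y. F p + integral {p..y} g)"
    by (intro continuous_intros indefinite_integral_continuous_1 set_lebesgue_integral_eq_integral(1) gi)
  moreover have "F y = F p + integral {p..y} g" if "y \<in> {p..q}" for y
  proof -
    have "F y - F p = (LINT t:{p..y}|lebesgue. g t)"
      using F that pq by (simp add: is_primitive_on_def)
    also have "\<dots> = integral {p..y} g"
      by (intro set_lebesgue_integral_eq_integral set_integrable_Icc_D[OF g]) (use that pq in auto)
    finally show ?thesis by simp
  qed
  ultimately have "continuous_on {p..q} F"
    by (metis (no_types, lifting) continuous_on_eq)
  then show "isCont F x"
    by (rule continuous_on_interior) (use pq in auto)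
qed

text \<open>
  Write the primitive on the support \<open>[p, q]\<close> of the test function as \<open>F
  p\<close> plus the integral of \<open>g\<close> from \<open>p\<close>. The constant
  contributes nothing, and exchanging the order of integration turns the rest into the integral
  of \<open>g y\<close> against \<open>\<phi> q - \<phi> y = - \<phi> y\<close>.
\<close>

lemma primitive_has_weak_derivative:
  assumes g: "g locally_integrable_on {a<..<b}" and F: "is_primitive_on F g {a<..<b}" and "a < b"
  shows "has_weak_derivative_on F g {a<..<b}"
  unfolding has_weak_derivative_on_def
proof (intro conjI ballI g)
  show Fli: "F locally_integrable_on {a<..<b}"
    by (intro continuous_locally_integrable primitive_continuous_on[OF g F] \<open>a < b\<close>)
  fix \<phi> assume \<phi>: "\<phi> \<in> test_functions {a<..<b}"
  obtain p q where pq: "smooth \<phi>" "a < p" "p < q" "q < b" "\<And>x. x \<notin> {p<..<q} \<Longrightarrow> \<phi> x = 0"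
    using \<phi> \<open>a < b\<close> by (auto simp: test_functions_Ioo_iff)
  have d\<phi>: "(\<phi> has_real_derivative deriv \<phi> x) (at x)" for x
    by (rule smooth_imp_DERIV[OF pq(1)])
  have dc: "continuous_on S (deriv \<phi>)" for S
    using pq(1) smooth_deriv_iff smooth_imp_continuous_on by blast
  have d0: "deriv \<phi> x = 0" if "x \<notin> {p..q}" for x
  proof -
    have "((\<lambda>x. 0) has_real_derivative 0) (at x)" by simp
    then have "(\<phi> has_real_derivative 0) (at x)"
      by (rule has_field_derivative_transform_within_open[where S = "- {p..q}"])
         (use that pq in auto)
    then show ?thesis by (rule DERIV_imp_deriv)
  qed
  define D where "D x = indicator {p..q} x * deriv \<phi> x" for x
  have Dm: "D \<in> borel_measurable borel"
    unfolding D_def using borel_measurable_continuous_onI[OF dc] by (intro borel_measurable_times) auto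
  have FTC: "(LINT x:{y..}|lborel. D x) = - \<phi> y" if "p \<le> y" "y \<le> q" for y
  proof -
    have "(LINT x:{y..}|lborel. D x) = (LINT x|lborel. deriv \<phi> x * indicator {y..q} x)"
      unfolding set_lebesgue_integral_def D_def using that
      by (intro Bochner_Integration.integral_cong) (auto split: split_indicator)
    also have "\<dots> = \<phi> q - \<phi> y"
      using dc[of UNIV] d\<phi> that by (intro integral_FTC_Icc_real) (auto simp: continuous_on_eq_continuous_at)
    finally show ?thesis using pq by simp
  qed
  have DI: "integrable lborel D"
    using borel_integrable_atLeastAtMost[of p q "deriv \<phi>"] dc[of UNIV]
    by (simp add: D_def[abs_def] continuous_on_eq_continuous_at mult.commute)
  have gst: "integrable lebesgue (\<lambda>x. indicator {p..q} x * g x)"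
    by (rule locally_integrable_onD[OF g]) (use pq in auto)
  obtain h where h: "h \<in> borel_measurable lborel" "AE x in lborel. indicator {p..q} x * g x = h x"
    using completion_ex_borel_measurable_real[OF borel_measurable_integrable[OF gst]] by blast
  have hm: "h \<in> borel_measurable lebesgue" by (rule measurable_completion[OF h(1)])
  have AEh: "AE x in lebesgue. h x = indicator {p..q} x * g x"
    using AE_completion[OF h(2)] by eventually_elim simp
  have "integrable lebesgue h"
    using gst integrable_cong_AE[OF hm borel_measurable_integrable[OF gst] AEh] by blast
  then have hi: "integrable lborel h" using h(1) by (simp add: integrable_completion)
  have hF: "(LINT y:{..x}|lborel. h y) = F x - F p" if x: "x \<in> {p..q}" for x
  proof -
    have "(LINT y:{..x}|lborel. h y) = (LINT y:{..x}|lebesgue. h y)"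
      unfolding set_lebesgue_integral_def using h(1) by (intro integral_completion[symmetric]) auto
    also have "\<dots> = (LINT y:{p..x}|lebesgue. g y)"
      unfolding set_lebesgue_integral_def
    proof (rule integral_cong_AE)
      show "(\<lambda>y. indicator {..x} y *\<^sub>R h y) \<in> borel_measurable lebesgue"
        using h(1) by (intro measurable_completion) simp
      show "(\<lambda>y. indicator {p..x} y *\<^sub>R g y) \<in> borel_measurable lebesgue"
        using locally_integrable_onD[OF g, of p x] x pq by (auto simp: subset_eq)
      show "AE y in lebesgue. indicator {..x} y *\<^sub>R h y = indicator {p..x} y *\<^sub>R g y"
        using AEh by eventually_elim (use x in \<open>auto split: split_indicator\<close>)
    qed
    also have "\<dots> = F x - F p" using F x pq by (simp add: is_primitive_on_def)
    finally show ?thesis .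
  qed
  have "(LINT x:{a<..<b}|lebesgue. F x * deriv \<phi> x) = (LINT x|lebesgue. (F x - F p) * D x) + F p * (LINT x|lebesgue. D x)"
  proof -
    have DIl: "integrable lebesgue D" using DI Dm by (simp add: integrable_completion)
    have "(\<lambda>x. F x * D x) = (\<lambda>x. indicator {a<..<b} x *\<^sub>R (F x * deriv \<phi> x))"
      using d0 pq by (auto simp: D_def split: split_indicator)
    then have FD: "integrable lebesgue (\<lambda>x. F x * D x)"
      using set_integrable_mult_test_function(2)[OF Fli \<open>a < b\<close> \<phi>] by (simp add: set_integrable_def)
    have "(LINT x:{a<..<b}|lebesgue. F x * deriv \<phi> x) = (LINT x|lebesgue. F x * D x)"
      unfolding set_lebesgue_integral_def using d0 pq
      by (intro Bochner_Integration.integral_cong) (auto simp: D_def split: split_indicator)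
    also have "\<dots> = (LINT x|lebesgue. F x * D x - F p * D x) + F p * (LINT x|lebesgue. D x)"
      using FD DIl by simp
    finally show ?thesis by (simp add: left_diff_distrib)
  qed
  also have "(LINT x|lebesgue. D x) = (LINT x|lborel. D x)"
    using Dm by (intro integral_completion) simp
  also have "(LINT x|lborel. D x) = (LINT x:{p..}|lborel. D x)"
    unfolding set_lebesgue_integral_def
    by (intro Bochner_Integration.integral_cong) (auto simp: D_def split: split_indicator)
  also have "\<dots> = 0" using FTC[of p] pq by simp
  also have "(LINT x|lebesgue. (F x - F p) * D x) = (LINT x|lebesgue. (LINT y:{..x}|lborel. h y) * D x)"
    by (intro Bochner_Integration.integral_cong) (auto simp: hF D_def split: split_indicator)
  also have "\<dots> = (LINT x|lborel. (LINT y:{..x}|lborel. h y) * D x)"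
  proof (rule integral_completion)
    have [measurable]: "h \<in> borel_measurable borel" using h by simp
    have "(\<lambda>x. LINT y|lborel. (if y \<le> x then h y else 0)) \<in> borel_measurable lborel"
      by measurable
    also have "(\<lambda>x. LINT y|lborel. (if y \<le> x then h y else 0)) = (\<lambda>x. LINT y:{..x}|lborel. h y)"
      unfolding set_lebesgue_integral_def
      by (intro ext Bochner_Integration.integral_cong) auto
    finally show "(\<lambda>x. (LINT y:{..x}|lborel. h y) * D x) \<in> borel_measurable lborel"
      using Dm by (intro borel_measurable_times) auto
  qed
  also have "\<dots> = (LINT y|lborel. h y * (LINT x:{y..}|lborel. D x))"
    by (rule iterated_integral_triangle[OF hi DI])
  also have "\<dots> = (LINT y|lborel. - (h y * \<phi> y))"
  proof (rule integral_cong_AE)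
    have [measurable]: "h \<in> borel_measurable borel" "D \<in> borel_measurable borel" using h Dm by auto
    have "(\<lambda>y. LINT x|lborel. (if y \<le> x then D x else 0)) \<in> borel_measurable lborel"
      by measurable
    also have "(\<lambda>y. LINT x|lborel. (if y \<le> x then D x else 0)) = (\<lambda>y. LINT x:{y..}|lborel. D x)"
      unfolding set_lebesgue_integral_def
      by (intro ext Bochner_Integration.integral_cong) auto
    finally show "(\<lambda>y. h y * (LINT x:{y..}|lborel. D x)) \<in> borel_measurable lborel"
      using h by (intro borel_measurable_times) auto
    show "(\<lambda>y. - (h y * \<phi> y)) \<in> borel_measurable lborel"
      using h smooth_imp_continuous_on[OF pq(1), of UNIV]
      by (intro borel_measurable_uminus borel_measurable_times) (auto intro: borel_measurable_continuous_onI)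
    show "AE y in lborel. h y * (LINT x:{y..}|lborel. D x) = - (h y * \<phi> y)"
      using h(2)
    proof eventually_elim
      case (elim y)
      then show ?case by (cases "y \<in> {p..q}") (auto simp: FTC)
    qed
  qed
  also have "\<dots> = (LINT y|lebesgue. - (h y * \<phi> y))"
    using h smooth_imp_continuous_on[OF pq(1), of UNIV]
    by (intro integral_completion[symmetric] borel_measurable_uminus borel_measurable_times)
       (auto intro: borel_measurable_continuous_onI)
  also have "\<dots> = - (LINT y|lebesgue. h y * \<phi> y)" by simp
  also have "(LINT y|lebesgue. h y * \<phi> y) = (LINT x:{a<..<b}|lebesgue. g x * \<phi> x)"
    unfolding set_lebesgue_integral_def
  proof (rule integral_cong_AE)
    show "(\<lambda>y. h y * \<phi> y) \<in> borel_measurable lebesgue"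
      by (intro borel_measurable_times hm borel_measurable_lebesgue_continuous smooth_imp_continuous_on pq)
    show "(\<lambda>y. indicator {a<..<b} y *\<^sub>R (g y * \<phi> y)) \<in> borel_measurable lebesgue"
      using set_integrable_mult_test_function(1)[OF g \<open>a < b\<close> \<phi>] by (auto simp: set_integrable_def)
    show "AE y in lebesgue. h y * \<phi> y = indicator {a<..<b} y *\<^sub>R (g y * \<phi> y)"
      using AEh
    proof eventually_elim
      case (elim y)
      then show ?case using pq by (cases "y \<in> {p<..<q}") auto
    qed
  qed
  finally show "(LINT x:{a<..<b}|lebesgue. F x * deriv \<phi> x) = - (LINT x:{a<..<b}|lebesgue. g x * \<phi> x)"
    by simp
qed

text \<open>
  The difference of \<open>f\<close> and any primitive of \<open>g\<close> has weak derivative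
  \<open>0\<close>, so it is constant almost everywhere.
\<close>

lemma weak_derivative_imp_primitive:
  assumes f: "has_weak_derivative_on f g {a<..<b}" and "a < b"
  shows "\<exists>F. is_primitive_on F g {a<..<b} \<and> (AE x in lebesgue. x \<in> {a<..<b} \<longrightarrow> f x = F x)"
proof -
  have li: "f locally_integrable_on {a<..<b}" "g locally_integrable_on {a<..<b}"
    using f by (auto simp: has_weak_derivative_on_def)
  obtain F where F: "is_primitive_on F g {a<..<b}"
    using primitive_exists[OF li(2)] by blast
  have wF: "has_weak_derivative_on F g {a<..<b}"
    by (rule primitive_has_weak_derivative[OF li(2) F \<open>a < b\<close>])
  then have Fli: "F locally_integrable_on {a<..<b}" by (simp add: has_weak_derivative_on_def)
  have "\<exists>C. AE x in lebesgue. x \<in> {a<..<b} \<longrightarrow> f x - F x = C"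
  proof (rule weakly_constant_imp_constant)
    show "(\<lambda>x. f x - F x) locally_integrable_on {a<..<b}"
      by (rule locally_integrable_on_diff[OF li(1) Fli])
    fix \<phi> assume \<phi>: "\<phi> \<in> test_functions {a<..<b}"
    have "(LINT x:{a<..<b}|lebesgue. f x * deriv \<phi> x) = (LINT x:{a<..<b}|lebesgue. F x * deriv \<phi> x)"
      using f wF \<phi> by (simp add: has_weak_derivative_on_def)
    then show "(LINT x:{a<..<b}|lebesgue. (f x - F x) * deriv \<phi> x) = 0"
      using set_integral_diff(2)[OF set_integrable_mult_test_function(2)[OF li(1) \<open>a < b\<close> \<phi>]
          set_integrable_mult_test_function(2)[OF Fli \<open>a < b\<close> \<phi>]]
      by (simp add: left_diff_distrib)
  qed fact
  then obtain C where C: "AE x in lebesgue. x \<in> {a<..<b} \<longrightarrow> f x - F x = C" by blast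
  have "is_primitive_on (\<lambda>x. F x + C) g {a<..<b}"
    using F by (simp add: is_primitive_on_def)
  moreover have "AE x in lebesgue. x \<in> {a<..<b} \<longrightarrow> f x = F x + C"
    using C by eventually_elim (auto simp: algebra_simps)
  ultimately show ?thesis by blast
qed

text \<open>
  Local integrability concerns compact subsets only; exhausting the interval by compact ones
  gives measurability on all of it.
\<close>

lemma locally_integrable_on_imp_measurable:
  assumes u: "u locally_integrable_on {a<..<b}"
  shows "(\<lambda>x. indicator {a<..<b} x * u x) \<in> borel_measurable lebesgue"
proof (rule borel_measurable_LIMSEQ_real)
  show "(\<lambda>x. indicator {a + 1 / real (Suc n)..b - 1 / real (Suc n)} x * u x) \<in> borel_measurable lebesgue" for n
  proof -
    have pos: "1 / real (Suc n) > 0" by simp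
    have "{a + 1 / real (Suc n)..b - 1 / real (Suc n)} \<subseteq> {a<..<b}"
    proof
      fix x assume "x \<in> {a + 1 / real (Suc n)..b - 1 / real (Suc n)}"
      with pos show "x \<in> {a<..<b}"
        unfolding atLeastAtMost_iff greaterThanLessThan_iff by linarith
    qed
    from locally_integrable_onD[OF u this] show ?thesis by (rule borel_measurable_integrable)
  qed
  fix x
  have "(\<lambda>n. indicator {a + 1 / real (Suc n)..b - 1 / real (Suc n)} x) \<longlonglongrightarrow> (indicator {a<..<b} x :: real)"
  proof (cases "x \<in> {a<..<b}")
    case True
    have "(\<lambda>n. 1 / real (Suc n)) \<longlonglongrightarrow> 0"
      by (rule LIMSEQ_Suc[OF lim_1_over_n])
    then have "\<forall>\<^sub>F n in sequentially. 1 / real (Suc n) < min (x - a) (b - x)"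
      using True by (intro order_tendstoD) auto
    then show ?thesis
      by (intro tendsto_eventually, eventually_elim) (use True in \<open>auto split: split_indicator\<close>)
  next
    case False
    have "1 / real (Suc n) > 0" for n by simp
    then have "x \<notin> {a + 1 / real (Suc n)..b - 1 / real (Suc n)}" for n
      using False by (smt (verit) atLeastAtMost_iff greaterThanLessThan_iff)
    with False show ?thesis by (simp del: of_nat_Suc atLeastAtMost_iff)
  qed
  then show "(\<lambda>n. indicator {a + 1 / real (Suc n)..b - 1 / real (Suc n)} x * u x)
      \<longlonglongrightarrow> indicator {a<..<b} x * u x"
    by (intro tendsto_intros)
qed

lemma primitive_diff_le_nn_integral:
  assumes g: "g locally_integrable_on {a<..<b}" and F: "is_primitive_on F g {a<..<b}"
    and h: "AE x in lebesgue. x \<in> {a<..<b} \<longrightarrow> g x = h x"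
    and xy: "a < x" "x \<le> y" "y < b"
  shows "ennreal \<bar>F y - F x\<bar> \<le> (\<integral>\<^sup>+t. ennreal (indicator {x..y} t * \<bar>h t\<bar>) \<partial>lborel)"
proof -
  have "integrable lebesgue (\<lambda>t. indicator {x..y} t * g t)"
    by (rule locally_integrable_onD[OF g]) (use xy in auto)
  then have "ennreal (norm (LINT t|lebesgue. indicator {x..y} t * g t))
      \<le> (\<integral>\<^sup>+t. ennreal (norm (indicator {x..y} t * g t)) \<partial>lebesgue)"
    by (rule integral_norm_bound_ennreal)
  also have "(\<integral>\<^sup>+t. ennreal (norm (indicator {x..y} t * g t)) \<partial>lebesgue)
      = (\<integral>\<^sup>+t. ennreal (indicator {x..y} t * \<bar>h t\<bar>) \<partial>lebesgue)"
    by (rule nn_integral_cong_AE) (use h in eventually_elim, use xy in \<open>auto split: split_indicator\<close>)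
  also have "\<dots> = (\<integral>\<^sup>+t. ennreal (indicator {x..y} t * \<bar>h t\<bar>) \<partial>lborel)"
    by (rule nn_integral_completion)
  finally show ?thesis
    using F xy by (simp add: is_primitive_on_def set_lebesgue_integral_def)
qed

section \<open>Tail estimates for the Jacobi weight\<close>

lemma jacobi_weight_nonneg [simp]: "0 \<le> jacobi_weight \<alpha> \<beta> x"
  by (simp add: jacobi_weight_def)

lemma jacobi_weight_measurable [measurable]: "jacobi_weight \<alpha> \<beta> \<in> borel_measurable borel"
  unfolding jacobi_weight_def[abs_def] by measurable

lemma jacobi_weight_uminus: "jacobi_weight \<alpha> \<beta> (- x) = jacobi_weight \<beta> \<alpha> x"
  by (simp add: jacobi_weight_def)

lemma powr_comparable:
  fixes x y :: real
  assumes "0 < x" "0 < y" "x \<le> 2 * y" "y \<le> 2 * x"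
  shows "x powr \<beta> \<le> 2 powr \<bar>\<beta>\<bar> * y powr \<beta>"
proof (cases "\<beta> \<ge> 0")
  case True
  then have "x powr \<beta> \<le> (2 * y) powr \<beta>" using assms by (intro powr_mono2) auto
  then show ?thesis using True assms by (simp add: powr_mult)
next
  case False
  then have "x powr \<beta> \<le> (y / 2) powr \<beta>" using assms by (intro powr_mono2') auto
  also have "\<dots> = 2 powr \<bar>\<beta>\<bar> * y powr \<beta>"
    using False assms by (simp add: powr_divide powr_minus_divide)
  finally show ?thesis .
qed

text \<open>
  For \<open>\<alpha> \<ge> 0\<close> the integrand is largest at \<open>t\<close>. For
  \<open>\<alpha> < 0\<close> it is smallest there, but in the variable \<open>u = 1 - x\<close>
  the average of the decreasing function \<open>u powr \<alpha>\<close> over \<open>[1 - b, 1 -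
  t]\<close> is at most its average over \<open>[0, 1 - t]\<close>, which equals \<open>(1 - t)
  powr \<alpha> / (\<alpha> + 1)\<close>.
\<close>

lemma nn_integral_powr_tail:
  assumes "\<alpha> > -1" "t \<le> b" "b \<le> 1"
  shows "(\<integral>\<^sup>+x. ennreal (indicator {t..b} x * (1 - x) powr \<alpha>) \<partial>lborel)
       \<le> ennreal (max 1 (1 / (\<alpha> + 1)) * (b - t) * (1 - t) powr \<alpha>)"
proof (cases "\<alpha> \<ge> 0")
  case True
  have "(\<integral>\<^sup>+x. ennreal (indicator {t..b} x * (1 - x) powr \<alpha>) \<partial>lborel)
      \<le> (\<integral>\<^sup>+x. ennreal ((1 - t) powr \<alpha>) * indicator {t..b} x \<partial>lborel)"
    using True assms by (intro nn_integral_mono) (auto split: split_indicator intro!: ennreal_leI powr_mono2)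
  also have "\<dots> = ennreal ((1 - t) powr \<alpha>) * ennreal (b - t)"
    using assms by (subst nn_integral_cmult_indicator) auto
  also have "\<dots> = ennreal (1 * (b - t) * (1 - t) powr \<alpha>)"
    using assms by (simp add: ennreal_mult mult.commute)
  also have "\<dots> \<le> ennreal (max 1 (1 / (\<alpha> + 1)) * (b - t) * (1 - t) powr \<alpha>)"
    using assms by (intro ennreal_leI mult_right_mono) auto
  finally show ?thesis .
next
  case False
  have "((\<lambda>x. (1 - x) powr \<alpha>) has_integral
      (- ((1 - b) powr (\<alpha> + 1)) / (\<alpha> + 1)) - (- ((1 - t) powr (\<alpha> + 1)) / (\<alpha> + 1))) {t..b}"
  proof (rule fundamental_theorem_of_calculus_interior[OF assms(2)])
    show "continuous_on {t..b} (\<lambda>x. - ((1 - x) powr (\<alpha> + 1)) / (\<alpha> + 1))"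
      using assms by (intro continuous_intros continuous_on_powr') auto
    show "((\<lambda>x. - ((1 - x) powr (\<alpha> + 1)) / (\<alpha> + 1)) has_vector_derivative (1 - x) powr \<alpha>) (at x)"
      if "x \<in> {t<..<b}" for x
    proof -
      have "((\<lambda>x. (1 - x) powr (\<alpha> + 1)) has_real_derivative (\<alpha> + 1) * (1 - x) powr (\<alpha> + 1 - 1) * (- 1)) (at x)"
        by (rule DERIV_chain2[OF has_real_derivative_powr])
           (use assms that in \<open>auto intro!: derivative_eq_intros\<close>)
      from DERIV_cdivide[OF DERIV_minus[OF this], of "\<alpha> + 1"] assms show ?thesis
        by (simp add: has_real_derivative_iff_has_vector_derivative)
    qed
  qed
  then have "(\<integral>\<^sup>+x. ennreal (indicator {t..b} x * (1 - x) powr \<alpha>) \<partial>lborel)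
      = ennreal ((- ((1 - b) powr (\<alpha> + 1)) / (\<alpha> + 1)) - (- ((1 - t) powr (\<alpha> + 1)) / (\<alpha> + 1)))"
    by (intro nn_integral_has_integral_lebesgue) auto
  also have "\<dots> = ennreal (1 / (\<alpha> + 1) * ((1 - t) powr (\<alpha> + 1) - (1 - b) powr (\<alpha> + 1)))"
    by (simp add: diff_divide_distrib)
  also have "\<dots> \<le> ennreal (1 / (\<alpha> + 1) * ((b - t) * (1 - t) powr \<alpha>))"
  proof (intro ennreal_leI mult_left_mono)
    have pow: "s powr (\<alpha> + 1) = s * s powr \<alpha>" if "0 \<le> s" for s :: real
      using that by (simp add: powr_add)
    have "(1 - b) * (1 - t) powr \<alpha> \<le> (1 - b) * (1 - b) powr \<alpha>"
      using False assms by (cases "b = 1") (auto intro!: mult_left_mono powr_mono2')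
    then show "(1 - t) powr (\<alpha> + 1) - (1 - b) powr (\<alpha> + 1) \<le> (b - t) * (1 - t) powr \<alpha>"
      using pow[of "1 - t"] pow[of "1 - b"] assms by (simp add: left_diff_distrib)
  qed (use assms in auto)
  also have "\<dots> \<le> ennreal (max 1 (1 / (\<alpha> + 1)) * ((b - t) * (1 - t) powr \<alpha>))"
    using assms by (intro ennreal_leI mult_right_mono) auto
  finally show ?thesis by (simp add: mult.assoc)
qed

definition tail_const :: "real \<Rightarrow> real \<Rightarrow> real" where
  "tail_const \<alpha> \<beta> = 2 powr \<bar>\<beta>\<bar> * max 1 (1 / (\<alpha> + 1))"

lemma tail_const_pos: "tail_const \<alpha> \<beta> > 0"
  by (simp add: tail_const_def)

text \<open>
  On \<open>[0, 1]\<close> the values of \<open>1 + x\<close> lie between \<open>1\<close> and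
  \<open>2\<close>, so only the factor \<open>(1 - x) powr \<alpha>\<close> matters, at the
  price of \<open>2 powr \<bar>\<beta>\<bar>\<close>.
\<close>

lemma nn_integral_jacobi_weight_tail:
  assumes "\<alpha> > -1" "0 \<le> t" "t \<le> b" "b \<le> 1"
  shows "(\<integral>\<^sup>+x. ennreal (indicator {t..b} x * jacobi_weight \<alpha> \<beta> x) \<partial>lborel)
       \<le> ennreal (tail_const \<alpha> \<beta> * (b - t) * jacobi_weight \<alpha> \<beta> t)"
proof -
  have "(\<integral>\<^sup>+x. ennreal (indicator {t..b} x * jacobi_weight \<alpha> \<beta> x) \<partial>lborel)
     \<le> (\<integral>\<^sup>+x. ennreal (2 powr \<bar>\<beta>\<bar> * (1 + t) powr \<beta>) * ennreal (indicator {t..b} x * (1 - x) powr \<alpha>) \<partial>lborel)"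
  proof (intro nn_integral_mono)
    fix x
    have "(1 - x) powr \<alpha> * (1 + x) powr \<beta> \<le> (1 - x) powr \<alpha> * (2 powr \<bar>\<beta>\<bar> * (1 + t) powr \<beta>)"
      if "x \<in> {t..b}"
      using that assms by (intro mult_left_mono powr_comparable) auto
    then show "ennreal (indicator {t..b} x * jacobi_weight \<alpha> \<beta> x)
      \<le> ennreal (2 powr \<bar>\<beta>\<bar> * (1 + t) powr \<beta>) * ennreal (indicator {t..b} x * (1 - x) powr \<alpha>)"
      by (auto simp: jacobi_weight_def ennreal_mult'[symmetric] mult_ac split: split_indicator intro!: ennreal_leI)
  qed
  also have "\<dots> = ennreal (2 powr \<bar>\<beta>\<bar> * (1 + t) powr \<beta>) * (\<integral>\<^sup>+x. ennreal (indicator {t..b} x * (1 - x) powr \<alpha>) \<partial>lborel)"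
    by (rule nn_integral_cmult) measurable
  also have "\<dots> \<le> ennreal (2 powr \<bar>\<beta>\<bar> * (1 + t) powr \<beta>) * ennreal (max 1 (1 / (\<alpha> + 1)) * (b - t) * (1 - t) powr \<alpha>)"
    by (intro mult_left_mono nn_integral_powr_tail assms) auto
  also have "\<dots> = ennreal (2 powr \<bar>\<beta>\<bar> * (1 + t) powr \<beta> * (max 1 (1 / (\<alpha> + 1)) * (b - t) * (1 - t) powr \<alpha>))"
    by (rule ennreal_mult'[symmetric]) simp
  also have "2 powr \<bar>\<beta>\<bar> * (1 + t) powr \<beta> * (max 1 (1 / (\<alpha> + 1)) * (b - t) * (1 - t) powr \<alpha>)
      = tail_const \<alpha> \<beta> * (b - t) * jacobi_weight \<alpha> \<beta> t"
    by (simp add: tail_const_def jacobi_weight_def)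
  finally show ?thesis .
qed

text \<open>
  In the variable \<open>\<theta> = arccos x\<close> this is the mean value theorem for
  \<open>cos\<close>, and \<open>sin\<close> increases on \<open>[0, \<pi>/2]\<close>.
\<close>

lemma diff_le_arccos_diff:
  assumes "0 \<le> t" "t \<le> b" "b \<le> 1"
  shows "b - t \<le> (arccos t - arccos b) * sqrt (1 - t\<^sup>2)"
proof (cases "t = b")
  case False
  then have lt: "arccos b < arccos t" using assms by (intro arccos_less_arccos) auto
  have "\<exists>z>arccos b. z < arccos t \<and> cos (arccos t) - cos (arccos b) = (arccos t - arccos b) * (- sin z)"
    using lt by (intro MVT2) (auto intro!: derivative_eq_intros)
  then obtain z where z: "arccos b < z" "z < arccos t" "t - b = (arccos t - arccos b) * (- sin z)"
    using assms by auto
  have "arccos t \<le> pi / 2" using assms arccos_le_pi2 by auto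
  moreover have "0 \<le> arccos b" using assms arccos_lbound by auto
  ultimately have "sin z \<le> sin (arccos t)"
    using z by (intro sin_mono_le_eq[THEN iffD2]) auto
  then have "(arccos t - arccos b) * sin z \<le> (arccos t - arccos b) * sin (arccos t)"
    using lt by (intro mult_left_mono) auto
  moreover have "sin (arccos t) = sqrt (1 - t\<^sup>2)" using assms by (intro sin_arccos) auto
  moreover have "b - t = (arccos t - arccos b) * sin z" using z(3) by simp
  ultimately show ?thesis by (simp only:)
qed simp

section \<open>Weighted Hardy inequalities on one side of a point\<close>

lemma nn_integral_inverse_sqrt:
  assumes "-1 \<le> m" "m \<le> x" "x \<le> 1"
  shows "(\<integral>\<^sup>+t. ennreal (indicator {m..x} t * (1 / sqrt (1 - t\<^sup>2))) \<partial>lborel) = ennreal (arccos m - arccos x)"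
proof -
  have "((\<lambda>t. 1 / sqrt (1 - t\<^sup>2)) has_integral (- arccos x - (- arccos m))) {m..x}"
  proof (rule fundamental_theorem_of_calculus_interior[OF assms(2)])
    show "continuous_on {m..x} (\<lambda>x. - arccos x)"
      using assms by (intro continuous_intros) auto
    show "((\<lambda>x. - arccos x) has_vector_derivative 1 / sqrt (1 - t\<^sup>2)) (at t)" if "t \<in> {m<..<x}" for t
      using DERIV_minus[OF DERIV_arccos[of t]] that assms
      by (simp add: has_real_derivative_iff_has_vector_derivative inverse_eq_divide)
  qed
  then have "(\<integral>\<^sup>+t. ennreal (indicator {m..x} t * (1 / sqrt (1 - t\<^sup>2))) \<partial>lborel) = ennreal (- arccos x - (- arccos m))"
  proof (rule nn_integral_has_integral_lebesgue[rotated])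
    fix t assume t: "t \<in> {m..x}"
    then have "\<bar>t\<bar> \<le> 1" using assms by auto
    then have "t\<^sup>2 \<le> 1" by (simp add: abs_square_le_1)
    then show "0 \<le> 1 / sqrt (1 - t\<^sup>2)" by simp
  qed
  then show ?thesis by simp
qed

text \<open>
  The Cauchy--Schwarz inequality for the splitting of \<open>\<bar>g\<bar>\<close> into
  \<open>\<bar>g\<bar> * (1 - t\<^sup>2) powr (1/4)\<close> and \<open>(1 - t\<^sup>2) powr (-
  1/4)\<close>; the square of the latter integrates to a difference of arccosines.
\<close>

lemma integral_squared_le_arccos_diff:
  fixes g :: "real \<Rightarrow> real"
  assumes [measurable]: "g \<in> borel_measurable borel" and mx: "-1 \<le> m" "m \<le> x" "x \<le> 1"
  shows "(\<integral>\<^sup>+t. ennreal (indicator {m..x} t * \<bar>g t\<bar>) \<partial>lborel)\<^sup>2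
     \<le> ennreal (arccos m - arccos x) * (\<integral>\<^sup>+t. ennreal (indicator {m..x} t * ((g t)\<^sup>2 * sqrt (1 - t\<^sup>2))) \<partial>lborel)"
proof -
  define r where "r t = sqrt (sqrt (1 - t\<^sup>2))" for t :: real
  have r: "0 \<le> r t" "(r t)\<^sup>2 = sqrt (1 - t\<^sup>2)" if "t \<in> {m..x}" for t
  proof -
    have "\<bar>t\<bar> \<le> 1" using that mx by auto
    then have "t\<^sup>2 \<le> 1" by (simp add: abs_square_le_1)
    then show "0 \<le> r t" "(r t)\<^sup>2 = sqrt (1 - t\<^sup>2)" by (auto simp: r_def)
  qed
  have r0: "r t \<noteq> 0" if "t \<in> {m..x}" "t \<noteq> -1" "t \<noteq> 1" for t
    using that by (auto simp: r_def power2_eq_1_iff)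
  have [measurable]: "r \<in> borel_measurable borel" unfolding r_def[abs_def] by measurable
  let ?f = "\<lambda>t. ennreal (indicator {m..x} t * (\<bar>g t\<bar> * r t))"
  let ?h = "\<lambda>t. ennreal (indicator {m..x} t * (1 / r t))"
  have f0: "0 \<le> indicator {m..x} t * (\<bar>g t\<bar> * r t)"
    and f2: "(indicator {m..x} t * (\<bar>g t\<bar> * r t))\<^sup>2 = indicator {m..x} t * ((g t)\<^sup>2 * sqrt (1 - t\<^sup>2))"
    and h0: "0 \<le> indicator {m..x} t * (1 / r t)"
    and h2: "(indicator {m..x} t * (1 / r t))\<^sup>2 = indicator {m..x} t * (1 / sqrt (1 - t\<^sup>2))" for t
    using r[of t] by (cases "t \<in> {m..x}"; simp add: power_mult_distrib power_divide)+
  have fm: "?f \<in> borel_measurable lborel" by measurable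
  have hm: "?h \<in> borel_measurable lborel" by measurable
  have fh: "?f t * ?h t = ennreal (indicator {m..x} t * \<bar>g t\<bar>)" if "t \<noteq> -1" "t \<noteq> 1" for t
    using r(1)[of t] r0[OF _ that] by (cases "t \<in> {m..x}") (simp_all add: ennreal_mult'[symmetric])
  have "AE t in lborel. t \<noteq> -1" "AE t in lborel. t \<noteq> (1::real)" by (auto intro: AE_lborel_singleton)
  then have "AE t in lborel. ennreal (indicator {m..x} t * \<bar>g t\<bar>) = ?f t * ?h t"
    by eventually_elim (rule fh[symmetric])
  then have "(\<integral>\<^sup>+t. ennreal (indicator {m..x} t * \<bar>g t\<bar>) \<partial>lborel) = (\<integral>\<^sup>+t. ?f t * ?h t \<partial>lborel)"
    by (rule nn_integral_cong_AE)
  then have "(\<integral>\<^sup>+t. ennreal (indicator {m..x} t * \<bar>g t\<bar>) \<partial>lborel)\<^sup>2 = (\<integral>\<^sup>+t. ?f t * ?h t \<partial>lborel)\<^sup>2"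
    by (rule arg_cong)
  also have "\<dots> \<le> (\<integral>\<^sup>+t. (?f t)\<^sup>2 \<partial>lborel) * (\<integral>\<^sup>+t. (?h t)\<^sup>2 \<partial>lborel)"
    by (rule Cauchy_Schwarz_nn_integral[OF fm hm])
  also have "(\<integral>\<^sup>+t. (?f t)\<^sup>2 \<partial>lborel) = (\<integral>\<^sup>+t. ennreal (indicator {m..x} t * ((g t)\<^sup>2 * sqrt (1 - t\<^sup>2))) \<partial>lborel)"
    by (intro nn_integral_cong trans[OF ennreal_power] f0 arg_cong[of _ _ ennreal] f2)
  also have "(\<integral>\<^sup>+t. (?h t)\<^sup>2 \<partial>lborel) = (\<integral>\<^sup>+t. ennreal (indicator {m..x} t * (1 / sqrt (1 - t\<^sup>2))) \<partial>lborel)"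
    by (intro nn_integral_cong trans[OF ennreal_power] h0 arg_cong[of _ _ ennreal] h2)
  also have "\<dots> = ennreal (arccos m - arccos x)" by (rule nn_integral_inverse_sqrt[OF mx])
  finally show ?thesis by (simp add: mult.commute)
qed

text \<open>
  The inner integral is estimated by the Cauchy--Schwarz inequality, at the cost of one factor
  \<open>d\<close>, the difference of arccosines. After exchanging the integrals, \<open>(g
  t)\<^sup>2 sqrt (1 - t\<^sup>2)\<close> is multiplied by the mass of \<open>[t, b]\<close>,
  and the tail bound provides the second factor \<open>d\<close> together with the missing
  \<open>sqrt (1 - t\<^sup>2)\<close>.
\<close>

lemma hardy_right:
  fixes g :: "real \<Rightarrow> real"
  assumes [measurable]: "g \<in> borel_measurable borel" and "\<alpha> > -1" and mb: "0 \<le> m" "m \<le> b" "b \<le> 1"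
  shows "(\<integral>\<^sup>+x. (\<integral>\<^sup>+t. ennreal (indicator {m..x} t * \<bar>g t\<bar>) \<partial>lborel)\<^sup>2
              * ennreal (indicator {m..b} x * jacobi_weight \<alpha> \<beta> x) \<partial>lborel)
     \<le> ennreal (tail_const \<alpha> \<beta> * (arccos m - arccos b)\<^sup>2)
       * (\<integral>\<^sup>+t. ennreal (indicator {m..b} t * ((g t)\<^sup>2 * (1 - t\<^sup>2) * jacobi_weight \<alpha> \<beta> t)) \<partial>lborel)"
proof -
  define d where "d = arccos m - arccos b"
  have d0: "0 \<le> d" using mb by (simp add: d_def arccos_le_arccos)
  define q where "q t = (g t)\<^sup>2 * sqrt (1 - t\<^sup>2)" for t
  have [measurable]: "q \<in> borel_measurable borel" unfolding q_def[abs_def] by measurable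
  have t1: "t\<^sup>2 \<le> 1" if "t \<in> {m..b}" for t
  proof -
    have "\<bar>t\<bar> \<le> 1" using that mb by auto
    then show ?thesis by (simp add: abs_square_le_1)
  qed
  have q0: "0 \<le> q t" if "t \<in> {m..b}" for t using t1[OF that] by (simp add: q_def)
  define k where "k x t = ennreal d * (ennreal (indicator {m..x} t * q t) * ennreal (indicator {m..b} x * jacobi_weight \<alpha> \<beta> x))" for x t
  have kalt: "k x t = ennreal d * ((if m \<le> t \<and> t \<le> x then ennreal (q t) else 0) * ennreal (indicator {m..b} x * jacobi_weight \<alpha> \<beta> x))" for x t
    by (simp add: k_def indicator_def)
  have km: "case_prod k \<in> borel_measurable (lborel \<Otimes>\<^sub>M lborel)"
    unfolding kalt[abs_def] by measurable
  have "(\<integral>\<^sup>+x. (\<integral>\<^sup>+t. ennreal (indicator {m..x} t * \<bar>g t\<bar>) \<partial>lborel)\<^sup>2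
              * ennreal (indicator {m..b} x * jacobi_weight \<alpha> \<beta> x) \<partial>lborel)
      \<le> (\<integral>\<^sup>+x. (\<integral>\<^sup>+t. k x t \<partial>lborel) \<partial>lborel)"
  proof (intro nn_integral_mono)
    fix x
    show "(\<integral>\<^sup>+t. ennreal (indicator {m..x} t * \<bar>g t\<bar>) \<partial>lborel)\<^sup>2
              * ennreal (indicator {m..b} x * jacobi_weight \<alpha> \<beta> x) \<le> (\<integral>\<^sup>+t. k x t \<partial>lborel)"
    proof (cases "x \<in> {m..b}")
      case True
      have "(\<integral>\<^sup>+t. ennreal (indicator {m..x} t * \<bar>g t\<bar>) \<partial>lborel)\<^sup>2
          \<le> ennreal (arccos m - arccos x) * (\<integral>\<^sup>+t. ennreal (indicator {m..x} t * q t) \<partial>lborel)"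
        unfolding q_def using True mb by (intro integral_squared_le_arccos_diff) auto
      also have "\<dots> \<le> ennreal d * (\<integral>\<^sup>+t. ennreal (indicator {m..x} t * q t) \<partial>lborel)"
        using True mb by (intro mult_right_mono ennreal_leI) (auto simp: d_def arccos_le_arccos)
      finally have "(\<integral>\<^sup>+t. ennreal (indicator {m..x} t * \<bar>g t\<bar>) \<partial>lborel)\<^sup>2
              * ennreal (indicator {m..b} x * jacobi_weight \<alpha> \<beta> x)
           \<le> ennreal d * (\<integral>\<^sup>+t. ennreal (indicator {m..x} t * q t) \<partial>lborel)
              * ennreal (indicator {m..b} x * jacobi_weight \<alpha> \<beta> x)"
        by (rule mult_right_mono) simp
      also have "\<dots> = (\<integral>\<^sup>+t. k x t \<partial>lborel)"
        unfolding k_def by (simp add: nn_integral_cmult nn_integral_multc mult.assoc)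
      finally show ?thesis .
    qed simp
  qed
  also have "\<dots> = (\<integral>\<^sup>+t. (\<integral>\<^sup>+x. k x t \<partial>lborel) \<partial>lborel)"
    by (rule lborel_pair.Fubini'[OF km, symmetric])
  also have "\<dots> \<le> (\<integral>\<^sup>+t. ennreal (tail_const \<alpha> \<beta> * d\<^sup>2)
       * ennreal (indicator {m..b} t * ((g t)\<^sup>2 * (1 - t\<^sup>2) * jacobi_weight \<alpha> \<beta> t)) \<partial>lborel)"
  proof (intro nn_integral_mono)
    fix t
    show "(\<integral>\<^sup>+x. k x t \<partial>lborel) \<le> ennreal (tail_const \<alpha> \<beta> * d\<^sup>2)
       * ennreal (indicator {m..b} t * ((g t)\<^sup>2 * (1 - t\<^sup>2) * jacobi_weight \<alpha> \<beta> t))"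
    proof (cases "t \<in> {m..b}")
      case True
      have "(\<integral>\<^sup>+x. k x t \<partial>lborel)
          = (\<integral>\<^sup>+x. ennreal (d * q t) * ennreal (indicator {t..b} x * jacobi_weight \<alpha> \<beta> x) \<partial>lborel)"
        using True d0 q0[OF True]
        by (intro nn_integral_cong) (auto simp: k_def ennreal_mult mult.assoc split: split_indicator)
      also have "\<dots> = ennreal (d * q t) * (\<integral>\<^sup>+x. ennreal (indicator {t..b} x * jacobi_weight \<alpha> \<beta> x) \<partial>lborel)"
        by (rule nn_integral_cmult) measurable
      also have "\<dots> \<le> ennreal (d * q t) * ennreal (tail_const \<alpha> \<beta> * (b - t) * jacobi_weight \<alpha> \<beta> t)"
        using True mb \<open>\<alpha> > -1\<close> by (intro mult_left_mono nn_integral_jacobi_weight_tail) auto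
      also have "\<dots> = ennreal ((d * q t) * (tail_const \<alpha> \<beta> * (b - t) * jacobi_weight \<alpha> \<beta> t))"
        using d0 q0[OF True] by (intro ennreal_mult'[symmetric]) auto
      also have "\<dots> \<le> ennreal ((tail_const \<alpha> \<beta> * d\<^sup>2) * ((g t)\<^sup>2 * (1 - t\<^sup>2) * jacobi_weight \<alpha> \<beta> t))"
      proof (rule ennreal_leI)
        have "b - t \<le> (arccos t - arccos b) * sqrt (1 - t\<^sup>2)"
          using True mb by (intro diff_le_arccos_diff) auto
        also have "\<dots> \<le> d * sqrt (1 - t\<^sup>2)"
          using True mb t1[OF True] by (intro mult_right_mono) (auto simp: d_def arccos_le_arccos)
        finally have "(d * q t) * (tail_const \<alpha> \<beta> * (b - t) * jacobi_weight \<alpha> \<beta> t)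
            \<le> (d * q t) * (tail_const \<alpha> \<beta> * (d * sqrt (1 - t\<^sup>2)) * jacobi_weight \<alpha> \<beta> t)"
          using d0 q0[OF True] tail_const_pos[of \<alpha> \<beta>]
          by (intro mult_left_mono mult_right_mono) auto
        also have "\<dots> = (tail_const \<alpha> \<beta> * d\<^sup>2) * ((g t)\<^sup>2 * (sqrt (1 - t\<^sup>2))\<^sup>2 * jacobi_weight \<alpha> \<beta> t)"
          by (simp add: q_def power2_eq_square algebra_simps)
        also have "(sqrt (1 - t\<^sup>2))\<^sup>2 = 1 - t\<^sup>2" using t1[OF True] by simp
        finally show "(d * q t) * (tail_const \<alpha> \<beta> * (b - t) * jacobi_weight \<alpha> \<beta> t)
          \<le> (tail_const \<alpha> \<beta> * d\<^sup>2) * ((g t)\<^sup>2 * (1 - t\<^sup>2) * jacobi_weight \<alpha> \<beta> t)" .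
      qed
      also have "\<dots> = ennreal (tail_const \<alpha> \<beta> * d\<^sup>2)
          * ennreal ((g t)\<^sup>2 * (1 - t\<^sup>2) * jacobi_weight \<alpha> \<beta> t)"
        using tail_const_pos[of \<alpha> \<beta>] by (intro ennreal_mult') simp
      finally show ?thesis using True by simp
    next
      case False
      then have "k x t = 0" for x
        by (auto simp: k_def split: split_indicator)
      then show ?thesis by simp
    qed
  qed
  also have "\<dots> = ennreal (tail_const \<alpha> \<beta> * d\<^sup>2)
       * (\<integral>\<^sup>+t. ennreal (indicator {m..b} t * ((g t)\<^sup>2 * (1 - t\<^sup>2) * jacobi_weight \<alpha> \<beta> t)) \<partial>lborel)"
    by (rule nn_integral_cmult) measurable
  finally show ?thesis by (simp only: d_def)
qed

lemma borel_measurable_integral_Icc: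
  fixes g :: "real \<Rightarrow> real"
  assumes [measurable]: "g \<in> borel_measurable borel"
  shows "(\<lambda>x. \<integral>\<^sup>+t. ennreal (indicator {x..m} t * \<bar>g t\<bar>) \<partial>lborel) \<in> borel_measurable borel" (is ?left)
    and "(\<lambda>x. \<integral>\<^sup>+t. ennreal (indicator {m..x} t * \<bar>g t\<bar>) \<partial>lborel) \<in> borel_measurable borel" (is ?right)
proof -
  have "(\<lambda>(x, t). if x \<le> t \<and> t \<le> m then ennreal \<bar>g t\<bar> else 0) \<in> borel_measurable (borel \<Otimes>\<^sub>M lborel)"
    by measurable
  from lborel.borel_measurable_nn_integral[OF this] show ?left
    by (rule back_subst[of "\<lambda>h. h \<in> borel_measurable borel"])
       (intro ext nn_integral_cong, simp add: indicator_def)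
  have "(\<lambda>(x, t). if m \<le> t \<and> t \<le> x then ennreal \<bar>g t\<bar> else 0) \<in> borel_measurable (borel \<Otimes>\<^sub>M lborel)"
    by measurable
  from lborel.borel_measurable_nn_integral[OF this] show ?right
    by (rule back_subst[of "\<lambda>h. h \<in> borel_measurable borel"])
       (intro ext nn_integral_cong, simp add: indicator_def)
qed

lemma nn_integral_lborel_uminus:
  fixes f :: "real \<Rightarrow> ennreal"
  assumes "f \<in> borel_measurable borel"
  shows "(\<integral>\<^sup>+x. f x \<partial>lborel) = (\<integral>\<^sup>+x. f (- x) \<partial>lborel)"
  by (subst nn_integral_real_affine[OF assms, of "-1" 0]) simp_all

text \<open>
  The reflection \<open>x \<mapsto> - x\<close> exchanges the roles of \<open>\<alpha>\<close>
  and \<open>\<beta>\<close>.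
\<close>

lemma hardy_left:
  fixes g :: "real \<Rightarrow> real"
  assumes [measurable]: "g \<in> borel_measurable borel" and "\<beta> > -1" and am: "-1 \<le> a" "a \<le> m" "m \<le> 0"
  shows "(\<integral>\<^sup>+x. (\<integral>\<^sup>+t. ennreal (indicator {x..m} t * \<bar>g t\<bar>) \<partial>lborel)\<^sup>2
              * ennreal (indicator {a..m} x * jacobi_weight \<alpha> \<beta> x) \<partial>lborel)
     \<le> ennreal (tail_const \<beta> \<alpha> * (arccos a - arccos m)\<^sup>2)
       * (\<integral>\<^sup>+t. ennreal (indicator {a..m} t * ((g t)\<^sup>2 * (1 - t\<^sup>2) * jacobi_weight \<alpha> \<beta> t)) \<partial>lborel)"
proof -
  have ind: "indicator {u..v} (- t) = (indicator {- v..- u} t :: real)" for u v t :: real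
    by (auto simp: indicator_def)
  note [measurable] = borel_measurable_integral_Icc(1)[OF assms(1)]
  have inner: "(\<integral>\<^sup>+t. ennreal (indicator {- x..m} t * \<bar>g t\<bar>) \<partial>lborel)
      = (\<integral>\<^sup>+t. ennreal (indicator {- m..x} t * \<bar>g (- t)\<bar>) \<partial>lborel)" for x
    using nn_integral_lborel_uminus[of "\<lambda>t. ennreal (indicator {- x..m} t * \<bar>g t\<bar>)"]
    by (simp add: ind)
  have "(\<integral>\<^sup>+x. (\<integral>\<^sup>+t. ennreal (indicator {x..m} t * \<bar>g t\<bar>) \<partial>lborel)\<^sup>2
              * ennreal (indicator {a..m} x * jacobi_weight \<alpha> \<beta> x) \<partial>lborel)
      = (\<integral>\<^sup>+x. (\<integral>\<^sup>+t. ennreal (indicator {- m..x} t * \<bar>g (- t)\<bar>) \<partial>lborel)\<^sup>2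
              * ennreal (indicator {- m..- a} x * jacobi_weight \<beta> \<alpha> x) \<partial>lborel)"
    by (rule trans[OF nn_integral_lborel_uminus]) (measurable, simp add: inner ind jacobi_weight_uminus)
  also have "\<dots> \<le> ennreal (tail_const \<beta> \<alpha> * (arccos (- m) - arccos (- a))\<^sup>2)
       * (\<integral>\<^sup>+t. ennreal (indicator {- m..- a} t * ((g (- t))\<^sup>2 * (1 - t\<^sup>2) * jacobi_weight \<beta> \<alpha> t)) \<partial>lborel)"
    using am by (intro hardy_right \<open>\<beta> > -1\<close>) auto
  also have "(\<integral>\<^sup>+t. ennreal (indicator {- m..- a} t * ((g (- t))\<^sup>2 * (1 - t\<^sup>2) * jacobi_weight \<beta> \<alpha> t)) \<partial>lborel)
      = (\<integral>\<^sup>+t. ennreal (indicator {a..m} t * ((g t)\<^sup>2 * (1 - t\<^sup>2) * jacobi_weight \<alpha> \<beta> t)) \<partial>lborel)"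
    by (rule trans[OF _ nn_integral_lborel_uminus[symmetric]]) (simp add: ind jacobi_weight_uminus, measurable)
  also have "arccos (- m) - arccos (- a) = arccos a - arccos m"
    using am by (simp add: arccos_minus)
  finally show ?thesis .
qed

text \<open>
  The conditions on \<open>m\<close> say that it is the point of \<open>[a, b]\<close> nearest
  to \<open>0\<close>: each of the intervals \<open>[a, m]\<close> and \<open>[m, b]\<close> is
  either a single point, and then a null set, or lies in the half of \<open>[-1, 1]\<close>
  where a one-sided inequality holds. The increments of \<open>F\<close> are controlled inside
  \<open>(-1, 1)\<close> only; at \<open>\<plusminus>1\<close> the weight vanishes because
  \<open>0 powr x = 0\<close>.
\<close>

lemma hardy_around_point:
  fixes g F :: "real \<Rightarrow> real"
  assumes [measurable]: "g \<in> borel_measurable borel"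
    and \<alpha>: "\<alpha> > -1" and \<beta>: "\<beta> > -1"
    and ab: "-1 \<le> a" "a \<le> m" "m \<le> b" "b \<le> 1"
    and mright: "0 \<le> m \<or> m = b" and mleft: "m \<le> 0 \<or> m = a"
    and right: "\<And>x. m \<le> x \<Longrightarrow> x < 1 \<Longrightarrow>
      ennreal \<bar>F x - F m\<bar> \<le> (\<integral>\<^sup>+t. ennreal (indicator {m..x} t * \<bar>g t\<bar>) \<partial>lborel)"
    and left: "\<And>x. -1 < x \<Longrightarrow> x \<le> m \<Longrightarrow>
      ennreal \<bar>F x - F m\<bar> \<le> (\<integral>\<^sup>+t. ennreal (indicator {x..m} t * \<bar>g t\<bar>) \<partial>lborel)"
  shows "(\<integral>\<^sup>+x. ennreal (indicator {a..b} x * ((F x - F m)\<^sup>2 * jacobi_weight \<alpha> \<beta> x)) \<partial>lborel)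
     \<le> ennreal ((tail_const \<alpha> \<beta> + tail_const \<beta> \<alpha>) * (arccos a - arccos b)\<^sup>2)
       * (\<integral>\<^sup>+t. ennreal (indicator {a..b} t * ((g t)\<^sup>2 * (1 - t\<^sup>2) * jacobi_weight \<alpha> \<beta> t)) \<partial>lborel)"
proof -
  note [measurable] = borel_measurable_integral_Icc
  define w where "w = jacobi_weight \<alpha> \<beta>"
  have [measurable]: "w \<in> borel_measurable borel" and w0: "0 \<le> w x" for x
    by (simp_all add: w_def)
  define R where "R = (\<integral>\<^sup>+t. ennreal (indicator {a..b} t * ((g t)\<^sup>2 * (1 - t\<^sup>2) * w t)) \<partial>lborel)"
  define d where "d = arccos a - arccos b"
  define A where "A x = (\<integral>\<^sup>+t. ennreal (indicator {m..x} t * \<bar>g t\<bar>) \<partial>lborel)\<^sup>2 * ennreal (indicator {m..b} x * w x)" for x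
  define B where "B x = (\<integral>\<^sup>+t. ennreal (indicator {x..m} t * \<bar>g t\<bar>) \<partial>lborel)\<^sup>2 * ennreal (indicator {a..m} x * w x)" for x
  have [measurable]: "A \<in> borel_measurable borel" "B \<in> borel_measurable borel"
    unfolding A_def[abs_def] B_def[abs_def] by measurable
  have arc: "arccos m \<le> arccos a" "arccos b \<le> arccos m"
    using ab by (auto intro!: arccos_le_arccos)
  have sub: "ennreal (indicator {u..v} t * ((g t)\<^sup>2 * (1 - t\<^sup>2) * w t))
      \<le> ennreal (indicator {a..b} t * ((g t)\<^sup>2 * (1 - t\<^sup>2) * w t))" if "a \<le> u" "v \<le> b" for u v t
    using that by (auto split: split_indicator)
  have "(\<integral>\<^sup>+x. ennreal (indicator {a..b} x * ((F x - F m)\<^sup>2 * w x)) \<partial>lborel) \<le> (\<integral>\<^sup>+x. A x + B x \<partial>lborel)"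
  proof (rule nn_integral_mono)
    fix x
    show "ennreal (indicator {a..b} x * ((F x - F m)\<^sup>2 * w x)) \<le> A x + B x"
    proof (cases "x \<in> {a..b} \<and> \<bar>x\<bar> \<noteq> 1")
      case False
      then have "indicator {a..b} x * ((F x - F m)\<^sup>2 * w x) = 0"
        by (auto simp: w_def jacobi_weight_def abs_if split: split_indicator if_splits)
      then show ?thesis by (simp only: ennreal_0 zero_le)
    next
      case True
      then have x: "a \<le> x" "x \<le> b" "-1 < x" "x < 1" using ab by (auto simp: abs_if split: if_splits)
      have sq: "ennreal ((F x - F m)\<^sup>2 * w x) = (ennreal \<bar>F x - F m\<bar>)\<^sup>2 * ennreal (w x)"
        by (simp add: ennreal_mult w0 ennreal_power)
      show ?thesis
      proof (cases "m \<le> x")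
        case True
        have "(ennreal \<bar>F x - F m\<bar>)\<^sup>2 * ennreal (w x) \<le> A x"
          unfolding A_def using right[OF True x(4)] True x
          by (auto intro!: mult_mono power_mono)
        then show ?thesis using x sq by (simp add: add_increasing2)
      next
        case False
        have "(ennreal \<bar>F x - F m\<bar>)\<^sup>2 * ennreal (w x) \<le> B x"
          unfolding B_def using left[OF x(3)] False x
          by (auto intro!: mult_mono power_mono)
        then show ?thesis using x sq by (simp add: add_increasing)
      qed
    qed
  qed
  also have "\<dots> = (\<integral>\<^sup>+x. A x \<partial>lborel) + (\<integral>\<^sup>+x. B x \<partial>lborel)"
    by (rule nn_integral_add) measurable
  also have "\<dots> \<le> ennreal (tail_const \<alpha> \<beta> * d\<^sup>2) * R + ennreal (tail_const \<beta> \<alpha> * d\<^sup>2) * R"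
  proof (rule add_mono)
    show "(\<integral>\<^sup>+x. A x \<partial>lborel) \<le> ennreal (tail_const \<alpha> \<beta> * d\<^sup>2) * R"
    proof (cases "0 \<le> m")
      case True
      have "(\<integral>\<^sup>+x. A x \<partial>lborel) \<le> ennreal (tail_const \<alpha> \<beta> * (arccos m - arccos b)\<^sup>2)
         * (\<integral>\<^sup>+t. ennreal (indicator {m..b} t * ((g t)\<^sup>2 * (1 - t\<^sup>2) * w t)) \<partial>lborel)"
        unfolding A_def w_def using True ab \<alpha> by (intro hardy_right) auto
      also have "\<dots> \<le> ennreal (tail_const \<alpha> \<beta> * d\<^sup>2) * R"
        unfolding R_def using arc ab tail_const_pos[of \<alpha> \<beta>]
        by (intro mult_mono ennreal_leI mult_left_mono power_mono nn_integral_mono sub) (auto simp: d_def)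
      finally show ?thesis .
    next
      case False
      then have "m = b" using mright by simp
      have "AE x in lborel. x \<noteq> b" by (rule AE_lborel_singleton)
      then have "AE x in lborel. A x = 0"
        by eventually_elim (auto simp: A_def \<open>m = b\<close> split: split_indicator)
      then have "(\<integral>\<^sup>+x. A x \<partial>lborel) = 0"
        by (subst nn_integral_0_iff_AE) auto
      then show ?thesis by simp
    qed
    show "(\<integral>\<^sup>+x. B x \<partial>lborel) \<le> ennreal (tail_const \<beta> \<alpha> * d\<^sup>2) * R"
    proof (cases "m \<le> 0")
      case True
      have "(\<integral>\<^sup>+x. B x \<partial>lborel) \<le> ennreal (tail_const \<beta> \<alpha> * (arccos a - arccos m)\<^sup>2)
         * (\<integral>\<^sup>+t. ennreal (indicator {a..m} t * ((g t)\<^sup>2 * (1 - t\<^sup>2) * w t)) \<partial>lborel)"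
        unfolding B_def w_def using True ab \<beta> by (intro hardy_left) auto
      also have "\<dots> \<le> ennreal (tail_const \<beta> \<alpha> * d\<^sup>2) * R"
        unfolding R_def using arc ab tail_const_pos[of \<beta> \<alpha>]
        by (intro mult_mono ennreal_leI mult_left_mono power_mono nn_integral_mono sub) (auto simp: d_def)
      finally show ?thesis .
    next
      case False
      then have "m = a" using mleft by simp
      have "AE x in lborel. x \<noteq> a" by (rule AE_lborel_singleton)
      then have "AE x in lborel. B x = 0"
        by eventually_elim (auto simp: B_def \<open>m = a\<close> split: split_indicator)
      then have "(\<integral>\<^sup>+x. B x \<partial>lborel) = 0"
        by (subst nn_integral_0_iff_AE) auto
      then show ?thesis by simp
    qed
  qed
  also have "\<dots> = ennreal ((tail_const \<alpha> \<beta> + tail_const \<beta> \<alpha>) * d\<^sup>2) * R"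
    using tail_const_pos[of \<alpha> \<beta>] tail_const_pos[of \<beta> \<alpha>]
    by (simp add: distrib_right[symmetric] ennreal_plus[symmetric] del: ennreal_plus)
  finally show ?thesis by (simp only: R_def d_def w_def)
qed

section \<open>Integrals against the Jacobi weight and the mean\<close>

lemma jacobi_weight_integrable:
  assumes "\<alpha> > -1" "\<beta> > -1" "-1 \<le> a" "b \<le> 1"
  shows "set_integrable lebesgue {a..b} (jacobi_weight \<alpha> \<beta>)"
proof -
  have fin: "(\<integral>\<^sup>+x. ennreal (indicator {0..1} x * jacobi_weight \<gamma> \<delta> x) \<partial>lborel) < \<infinity>" if "\<gamma> > -1" for \<gamma> \<delta>
    using nn_integral_jacobi_weight_tail[OF that, of 0 1 \<delta>] by (simp add: le_less_trans[OF _ ennreal_less_top])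
  have "(\<integral>\<^sup>+x. ennreal (norm (indicator {a..b} x *\<^sub>R jacobi_weight \<alpha> \<beta> x)) \<partial>lborel)
     \<le> (\<integral>\<^sup>+x. ennreal (indicator {0..1} x * jacobi_weight \<alpha> \<beta> x)
          + ennreal (indicator {0..1} (- x) * jacobi_weight \<beta> \<alpha> (- x)) \<partial>lborel)"
    using assms by (intro nn_integral_mono) (auto simp: jacobi_weight_uminus split: split_indicator)
  also have "\<dots> = (\<integral>\<^sup>+x. ennreal (indicator {0..1} x * jacobi_weight \<alpha> \<beta> x) \<partial>lborel)
      + (\<integral>\<^sup>+x. ennreal (indicator {0..1} (- x) * jacobi_weight \<beta> \<alpha> (- x)) \<partial>lborel)"
    by (rule nn_integral_add) measurable
  also have "(\<integral>\<^sup>+x. ennreal (indicator {0..1} (- x) * jacobi_weight \<beta> \<alpha> (- x)) \<partial>lborel)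
      = (\<integral>\<^sup>+x. ennreal (indicator {0..1} x * jacobi_weight \<beta> \<alpha> x) \<partial>lborel)"
    by (rule nn_integral_lborel_uminus[symmetric]) measurable
  also have "(\<integral>\<^sup>+x. ennreal (indicator {0..1} x * jacobi_weight \<alpha> \<beta> x) \<partial>lborel)
      + (\<integral>\<^sup>+x. ennreal (indicator {0..1} x * jacobi_weight \<beta> \<alpha> x) \<partial>lborel) < \<infinity>"
    using fin[OF assms(1), of \<beta>] fin[OF assms(2), of \<alpha>] by simp
  finally have "integrable lborel (\<lambda>x. indicator {a..b} x *\<^sub>R jacobi_weight \<alpha> \<beta> x)"
    by (intro integrableI_bounded) simp_all
  then show ?thesis
    unfolding set_integrable_def by (subst integrable_completion) simp_all
qed

lemma jacobi_mass_pos: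
  assumes "\<alpha> > -1" "\<beta> > -1" "-1 \<le> a" "a < b" "b \<le> 1"
  shows "jacobi_mass \<alpha> \<beta> {a..b} > 0"
proof -
  have int: "integrable lebesgue (\<lambda>x. indicator {a..b} x *\<^sub>R jacobi_weight \<alpha> \<beta> x)"
    using jacobi_weight_integrable[of \<alpha> \<beta> a b] assms by (simp add: set_integrable_def)
  have "jacobi_mass \<alpha> \<beta> {a..b} \<noteq> 0"
  proof
    assume "jacobi_mass \<alpha> \<beta> {a..b} = 0"
    then have "AE x in lebesgue. indicator {a..b} x *\<^sub>R jacobi_weight \<alpha> \<beta> x = 0"
      using integral_nonneg_eq_0_iff_AE[OF int] by (simp add: jacobi_mass_def set_lebesgue_integral_def)
    then have "AE x in lebesgue. x \<notin> {a<..<b}"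
      by eventually_elim (use assms in \<open>auto simp: jacobi_weight_def split: split_indicator\<close>)
    then have "AE x in lborel. x \<notin> {a<..<b}" by (simp add: AE_completion_iff)
    then have "emeasure lborel {a<..<b} = 0"
      by (subst (asm) AE_iff_measurable[where N = "{a<..<b}"]) auto
    with assms show False by simp
  qed
  moreover have "0 \<le> jacobi_mass \<alpha> \<beta> {a..b}"
    unfolding jacobi_mass_def set_lebesgue_integral_def by (intro integral_nonneg_AE) auto
  ultimately show ?thesis by simp
qed

text \<open>
  The second moment about \<open>k\<close> exceeds the one about the mean by \<open>(k -
  \<mu>)\<^sup>2\<close> times the total mass.
\<close>

lemma variance_le_second_moment:
  fixes f w :: "real \<Rightarrow> real"
  assumes w: "set_integrable M S w" and fw: "set_integrable M S (\<lambda>x. f x * w x)"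
    and ffw: "set_integrable M S (\<lambda>x. (f x)\<^sup>2 * w x)"
    and pos: "(LINT x:S|M. w x) > 0"
  defines "\<mu> \<equiv> 1 / (LINT x:S|M. w x) * (LINT x:S|M. f x * w x)"
  shows "(LINT x:S|M. (f x - \<mu>)\<^sup>2 * w x) \<le> (LINT x:S|M. (f x - k)\<^sup>2 * w x)"
    and "set_integrable M S (\<lambda>x. (f x - k)\<^sup>2 * w x)"
proof -
  define W where "W = (LINT x:S|M. w x)"
  define B where "B = (LINT x:S|M. f x * w x)"
  have expand: "(f x - k)\<^sup>2 * w x = (f x)\<^sup>2 * w x - (2 * k) * (f x * w x) + k\<^sup>2 * w x" for k x
    by (simp add: power2_eq_square algebra_simps)
  have int: "set_integrable M S (\<lambda>x. (2 * k) * (f x * w x))" "set_integrable M S (\<lambda>x. k\<^sup>2 * w x)"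
    "set_integrable M S (\<lambda>x. (f x)\<^sup>2 * w x - (2 * k) * (f x * w x))" for k
    using w fw ffw by (auto intro!: set_integrable_mult_right set_integral_diff(1))
  show "set_integrable M S (\<lambda>x. (f x - k)\<^sup>2 * w x)"
    unfolding expand by (intro set_integral_add(1) int)
  have val: "(LINT x:S|M. (f x - k)\<^sup>2 * w x) = (LINT x:S|M. (f x)\<^sup>2 * w x) - 2 * k * B + k\<^sup>2 * W" for k
    unfolding expand by (simp add: set_integral_add(2) set_integral_diff(2) int ffw W_def B_def)
  have "B = \<mu> * W" using pos by (simp add: \<mu>_def W_def B_def)
  then have "(LINT x:S|M. (f x - k)\<^sup>2 * w x) - (LINT x:S|M. (f x - \<mu>)\<^sup>2 * w x) = (k - \<mu>)\<^sup>2 * W"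
    unfolding val by (simp add: power2_eq_square algebra_simps)
  also have "\<dots> \<ge> 0" using pos by (simp add: W_def)
  finally show "(LINT x:S|M. (f x - \<mu>)\<^sup>2 * w x) \<le> (LINT x:S|M. (f x - k)\<^sup>2 * w x)" by simp
qed

section \<open>The Poincare inequality\<close>

theorem theorem7p1:
  fixes \<alpha> \<beta> :: real
  assumes "\<alpha> > -1" and "\<beta> > -1"
  shows "\<exists>c>0. \<forall>f f' a b.
           f \<in> jacobi_form_domain \<alpha> \<beta> \<longrightarrow>
           has_weak_derivative_on f f' {-1<..<1} \<longrightarrow>
           -1 \<le> a \<longrightarrow> a < b \<longrightarrow> b \<le> 1 \<longrightarrow>
           (LINT x:{a..b}|lebesgue.
              \<bar>f x - jacobi_mean \<alpha> \<beta> f {a..b}\<bar>\<^sup>2 * jacobi_weight \<alpha> \<beta> x)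
           \<le> c * (arccos a - arccos b)\<^sup>2 *
             (LINT x:{a..b}|lebesgue.
                \<bar>f' x\<bar>\<^sup>2 * (1 - x\<^sup>2) * jacobi_weight \<alpha> \<beta> x)"
proof (intro exI[of _ "tail_const \<alpha> \<beta> + tail_const \<beta> \<alpha>"] conjI allI impI)
  let ?c = "tail_const \<alpha> \<beta> + tail_const \<beta> \<alpha>"
  show "0 < ?c" by (intro add_pos_pos tail_const_pos)
  fix f f' :: "real \<Rightarrow> real" and a b :: real
  assume dom: "f \<in> jacobi_form_domain \<alpha> \<beta>" and weak: "has_weak_derivative_on f f' {-1<..<1}"
    and ab: "-1 \<le> a" "a < b" "b \<le> 1"
  define w where "w = jacobi_weight \<alpha> \<beta>"
  \<comment> \<open>since \<open>0 powr x = 0\<close> for every exponent, endpoint values of \<open>f\<close> and \<open>f'\<close> do not contribute\<close>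
  have w0: "0 \<le> w x" and wend: "x \<in> {-1..1} \<Longrightarrow> x \<notin> {-1<..<1} \<Longrightarrow> w x = 0" for x
    by (auto simp: w_def jacobi_weight_def)
  have wm: "w \<in> borel_measurable lebesgue"
    unfolding w_def by (intro measurable_completion) simp
  have li: "f locally_integrable_on {-1<..<1}" "f' locally_integrable_on {-1<..<1}"
    using weak by (auto simp: has_weak_derivative_on_def)
  have sub: "{a..b} \<subseteq> {-1..1}" using ab by auto
  define f0 where "f0 x = indicator {-1<..<1} x * f x" for x
  define f0' where "f0' x = indicator {-1<..<1} x * f' x" for x
  have f0m: "f0 \<in> borel_measurable lebesgue" "f0' \<in> borel_measurable lebesgue"
    using li[THEN locally_integrable_on_imp_measurable] by (simp_all add: f0_def[abs_def] f0'_def[abs_def])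
  have ffw1: "set_integrable lebesgue {-1..1} (\<lambda>x. (f x)\<^sup>2 * w x)"
    using dom by (simp add: jacobi_form_domain_def w_def)
  \<comment> \<open>integrability is known for one weak derivative only; uniqueness transfers it to \<open>f'\<close>\<close>
  obtain f1 where f1: "has_weak_derivative_on f f1 {-1<..<1}"
    "set_integrable lebesgue {-1..1} (\<lambda>x. (1 - x\<^sup>2) * (f1 x)\<^sup>2 * w x)"
    using dom by (auto simp: jacobi_form_domain_def w_def)
  have f'f1: "AE x in lebesgue. x \<in> {-1<..<1} \<longrightarrow> f' x = f1 x"
    by (rule weak_derivative_unique[OF weak f1(1)]) simp
  obtain F where F: "is_primitive_on F f' {-1<..<1}"
    and fF: "AE x in lebesgue. x \<in> {-1<..<1} \<longrightarrow> f x = F x"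
    using weak_derivative_imp_primitive[OF weak] by auto
  \<comment> \<open>a Borel version of the weak derivative, as the exchange of integrals takes place in \<open>lborel\<close>\<close>
  obtain g where g: "g \<in> borel_measurable lborel" "AE x in lborel. indicator {-1<..<1} x * f' x = g x"
    using completion_ex_borel_measurable_real[OF locally_integrable_on_imp_measurable[OF li(2)]] by blast
  have f'g: "AE x in lebesgue. x \<in> {-1<..<1} \<longrightarrow> f' x = g x"
    using AE_completion[OF g(2)] by eventually_elim auto

  have intw: "set_integrable lebesgue {a..b} w"
    unfolding w_def using jacobi_weight_integrable assms ab by blast
  have intffw: "set_integrable lebesgue {a..b} (\<lambda>x. (f x)\<^sup>2 * w x)"
    by (rule set_integrable_subset[OF ffw1 _ sub]) simp
  have intfw: "set_integrable lebesgue {a..b} (\<lambda>x. f x * w x)"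
    unfolding set_integrable_def
  proof (rule Bochner_Integration.integrable_bound)
    show "integrable lebesgue (\<lambda>x. indicator {a..b} x *\<^sub>R w x + indicator {a..b} x *\<^sub>R ((f x)\<^sup>2 * w x))"
      using intw intffw unfolding set_integrable_def by (rule Bochner_Integration.integrable_add)
    have "(\<lambda>x. indicator {a..b} x *\<^sub>R (f x * w x)) = (\<lambda>x. indicator {a..b} x * (f0 x * w x))"
      using wend sub by (fastforce simp: f0_def split: split_indicator)
    then show "(\<lambda>x. indicator {a..b} x *\<^sub>R (f x * w x)) \<in> borel_measurable lebesgue"
      using f0m wm
      by (simp only:) (intro borel_measurable_times measurable_completion[of "indicator {a..b}"], simp_all)
    have "\<bar>y\<bar> \<le> 1 + y\<^sup>2" for y :: real
      using sum_squares_bound[of "\<bar>y\<bar>" 1] abs_ge_zero[of y] by simp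
    then have "\<bar>f x\<bar> * w x \<le> (1 + (f x)\<^sup>2) * w x" for x
      using w0 by (intro mult_right_mono)
    then show "AE x in lebesgue. norm (indicator {a..b} x *\<^sub>R (f x * w x))
        \<le> norm (indicator {a..b} x *\<^sub>R w x + indicator {a..b} x *\<^sub>R ((f x)\<^sup>2 * w x))"
      using w0 by (intro AE_I2) (auto simp: abs_mult algebra_simps split: split_indicator)
  qed
  have mass: "(LINT x:{a..b}|lebesgue. w x) > 0"
    using jacobi_mass_pos[OF assms ab] by (simp add: jacobi_mass_def w_def)

  define R where "R = (LINT x:{a..b}|lebesgue. (f' x)\<^sup>2 * (1 - x\<^sup>2) * w x)"
  have x1: "0 \<le> 1 - x\<^sup>2" if "x \<in> {a..b}" for x
  proof -
    have "\<bar>x\<bar> \<le> 1" using that ab by auto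
    then show ?thesis by (simp add: abs_square_le_1)
  qed
  have R: "(\<integral>\<^sup>+t. ennreal (indicator {a..b} t * ((g t)\<^sup>2 * (1 - t\<^sup>2) * w t)) \<partial>lborel) = ennreal R"
  proof -
    have "integrable lebesgue (\<lambda>x. indicator {a..b} x *\<^sub>R ((1 - x\<^sup>2) * (f1 x)\<^sup>2 * w x))"
      using set_integrable_subset[OF f1(2) _ sub] by (simp add: set_integrable_def)
    moreover have AE1: "AE x in lebesgue. indicator {a..b} x *\<^sub>R ((1 - x\<^sup>2) * (f1 x)\<^sup>2 * w x)
        = indicator {a..b} x *\<^sub>R ((f' x)\<^sup>2 * (1 - x\<^sup>2) * w x)"
      using f'f1 by eventually_elim (use wend sub in \<open>fastforce split: split_indicator\<close>)
    moreover have "(\<lambda>x. indicator {a..b} x *\<^sub>R ((f' x)\<^sup>2 * (1 - x\<^sup>2) * w x)) \<in> borel_measurable lebesgue"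
    proof -
      have "(\<lambda>x. indicator {a..b} x *\<^sub>R ((f' x)\<^sup>2 * (1 - x\<^sup>2) * w x))
          = (\<lambda>x. (indicator {a..b} x * (1 - x\<^sup>2)) * ((f0' x)\<^sup>2 * w x))"
        using wend sub by (fastforce simp: f0'_def split: split_indicator)
      then show ?thesis
        using f0m wm
        by (simp only:) (intro borel_measurable_times borel_measurable_power
            measurable_completion[of "\<lambda>x. indicator {a..b} x * (1 - x\<^sup>2)"], simp_all)
    qed
    ultimately have int: "integrable lebesgue (\<lambda>x. indicator {a..b} x *\<^sub>R ((f' x)\<^sup>2 * (1 - x\<^sup>2) * w x))"
      using integrable_cong_AE borel_measurable_integrable by blast
    have "(\<integral>\<^sup>+t. ennreal (indicator {a..b} t * ((g t)\<^sup>2 * (1 - t\<^sup>2) * w t)) \<partial>lborel)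
        = (\<integral>\<^sup>+t. ennreal (indicator {a..b} t * ((g t)\<^sup>2 * (1 - t\<^sup>2) * w t)) \<partial>lebesgue)"
      by (rule nn_integral_completion[symmetric])
    also have "\<dots> = (\<integral>\<^sup>+t. ennreal (indicator {a..b} t *\<^sub>R ((f' t)\<^sup>2 * (1 - t\<^sup>2) * w t)) \<partial>lebesgue)"
      by (rule nn_integral_cong_AE, use f'g in eventually_elim) (use wend sub in \<open>fastforce split: split_indicator\<close>)
    also have "\<dots> = ennreal R"
      unfolding R_def set_lebesgue_integral_def
      by (rule nn_integral_eq_integral[OF int]) (use x1 w0 in \<open>auto split: split_indicator\<close>)
    finally show ?thesis .
  qed
  have R0: "0 \<le> R"
    unfolding R_def set_lebesgue_integral_def
    by (intro integral_nonneg_AE AE_I2) (use x1 w0 in \<open>auto split: split_indicator\<close>)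

  \<comment> \<open>the point of the interval nearest to \<open>0\<close>\<close>
  define m where "m = max a (min b 0)"
  have m: "a \<le> m" "m \<le> b" "-1 < m" "m < 1" "0 \<le> m \<or> m = b" "m \<le> 0 \<or> m = a"
    using ab by (auto simp: m_def)
  have "ennreal (LINT x:{a..b}|lebesgue. (f x - F m)\<^sup>2 * w x)
      = (\<integral>\<^sup>+x. ennreal (indicator {a..b} x *\<^sub>R ((f x - F m)\<^sup>2 * w x)) \<partial>lebesgue)"
    unfolding set_lebesgue_integral_def
    using variance_le_second_moment(2)[OF intw intfw intffw mass] w0
    by (intro nn_integral_eq_integral[symmetric]) (auto simp: set_integrable_def)
  also have "\<dots> = (\<integral>\<^sup>+x. ennreal (indicator {a..b} x * ((F x - F m)\<^sup>2 * w x)) \<partial>lebesgue)"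
    by (rule nn_integral_cong_AE, use fF in eventually_elim) (use wend sub in \<open>fastforce split: split_indicator\<close>)
  also have "\<dots> = (\<integral>\<^sup>+x. ennreal (indicator {a..b} x * ((F x - F m)\<^sup>2 * w x)) \<partial>lborel)"
    by (rule nn_integral_completion)
  also have "\<dots> \<le> ennreal (?c * (arccos a - arccos b)\<^sup>2)
       * (\<integral>\<^sup>+t. ennreal (indicator {a..b} t * ((g t)\<^sup>2 * (1 - t\<^sup>2) * w t)) \<partial>lborel)"
    unfolding w_def
  proof (rule hardy_around_point)
    show "ennreal \<bar>F x - F m\<bar> \<le> (\<integral>\<^sup>+t. ennreal (indicator {m..x} t * \<bar>g t\<bar>) \<partial>lborel)"
      if "m \<le> x" "x < 1" for x
      by (rule primitive_diff_le_nn_integral[OF li(2) F f'g m(3) that])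
    show "ennreal \<bar>F x - F m\<bar> \<le> (\<integral>\<^sup>+t. ennreal (indicator {x..m} t * \<bar>g t\<bar>) \<partial>lborel)"
      if "-1 < x" "x \<le> m" for x
      using primitive_diff_le_nn_integral[OF li(2) F f'g that m(4)] by (simp add: abs_minus_commute)
  qed (use assms ab m g in auto)
  also have "\<dots> = ennreal (?c * (arccos a - arccos b)\<^sup>2 * R)"
    unfolding R using R0 by (rule ennreal_mult''[symmetric])
  finally have "(LINT x:{a..b}|lebesgue. (f x - F m)\<^sup>2 * w x) \<le> ?c * (arccos a - arccos b)\<^sup>2 * R"
    using R0 \<open>0 < ?c\<close> by (subst (asm) ennreal_le_iff) auto
  moreover have "(LINT x:{a..b}|lebesgue. (f x - jacobi_mean \<alpha> \<beta> f {a..b})\<^sup>2 * w x)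
      \<le> (LINT x:{a..b}|lebesgue. (f x - F m)\<^sup>2 * w x)"
    using variance_le_second_moment(1)[OF intw intfw intffw mass]
    by (simp add: jacobi_mean_def jacobi_mass_def w_def)
  ultimately show "(LINT x:{a..b}|lebesgue. \<bar>f x - jacobi_mean \<alpha> \<beta> f {a..b}\<bar>\<^sup>2 * jacobi_weight \<alpha> \<beta> x)
      \<le> ?c * (arccos a - arccos b)\<^sup>2 * (LINT x:{a..b}|lebesgue. \<bar>f' x\<bar>\<^sup>2 * (1 - x\<^sup>2) * jacobi_weight \<alpha> \<beta> x)"
    by (simp add: R_def w_def)
qed

end
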